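(* Let $\nu>-1$ and $B_n=\gamma_{\nu,1}^4\zeta_{4n+4}(\nu)-\zeta_{4n}(\nu)$ for $n\in\mathbb{N}$. Then for every $n\in\mathbb{N}$ and all $0<|x|<\gamma_{\nu,1}$, $$\frac{S_{4n}(x)+16(\nu+1)_3\,r\,x^{4n+4}}{\gamma_{\nu,1}^4-x^4}<-\frac{4(\nu+1)_3}{x^3}\cdot\frac{\mathscr{W}_\nu'(x)}{\mathscr{W}_\nu(x)}<\frac{S_{4n}(x)+16(\nu+1)_3\,s\,x^{4n+4}}{\gamma_{\nu,1}^4-x^4},$$ where $$r=\frac{1}{\gamma_{\nu,1}^{4n+4}}\left(1-\frac{\gamma_{\nu,1}^4}{16(\nu+1)_3}-\sum_{m=1}^nB_m\gamma_{\nu,1}^{4m}\right),\quad s=B_{n+1},\quad S_{4n}(x)=\gamma_{\nu,1}^4+16(\nu+1)_3\sum_{m=1}^nB_mx^{4m}.$$ Moreover, the constants $r$ and $s$ are sharp.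
   Context: $J_\nu$ and $I_\nu$ are the Bessel and modified Bessel functions of the first kind; $\mathbb{N}=\{1,2,\dots\}$; $(\nu+1)_3=(\nu+1)(\nu+2)(\nu+3)$. The cross-product is $W_\nu(z)=J_\nu(z)I_\nu'(z)-J_\nu'(z)I_\nu(z)=J_{\nu+1}(z)I_\nu(z)+J_\nu(z)I_{\nu+1}(z)$; $\gamma_{\nu,n}$ is its $n$th positive zero (in increasing order); its normalization is $\mathscr{W}_\nu(z)=2^{2\nu}z^{-2\nu-1}\Gamma(\nu+1)\Gamma(\nu+2)W_\nu(z)$, an even entire function with $\mathscr{W}_\nu(0)=1$. The Rayleigh functions are $\zeta_{4m}(\nu)=\sum_{n\ge1}\gamma_{\nu,n}^{-4m}$ for $m\in\mathbb{N}$. Sharpness means that $r$ cannot be replaced by a larger constant in the left inequality and $s$ cannot be replaced by a smaller constant in the right inequality, if these are to hold for all $0<|x|<\gamma_{\nu,1}$. *)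

theory Defs
  imports "HOL-Analysis.Analysis"
begin

text \<open>
  All functions are restricted to the real line. The Bessel functions are used at positive
  arguments only: for \<open>x \<le> 0\<close> the value of \<open>(x / 2) powr \<nu>\<close> is a convention of the library.
\<close>

definition bessel_J :: "real \<Rightarrow> real \<Rightarrow> real" where
  "bessel_J \<nu> x =
     (x / 2) powr \<nu> * (\<Sum>k. (-1) ^ k / (fact k * Gamma (\<nu> + real k + 1)) * (x / 2) ^ (2 * k))"

definition bessel_I :: "real \<Rightarrow> real \<Rightarrow> real" where
  "bessel_I \<nu> x =
     (x / 2) powr \<nu> * (\<Sum>k. 1 / (fact k * Gamma (\<nu> + real k + 1)) * (x / 2) ^ (2 * k))"

definition cross_W :: "real \<Rightarrow> real \<Rightarrow> real" where
  "cross_W \<nu> x = bessel_J \<nu> x * deriv (bessel_I \<nu>) x - deriv (bessel_J \<nu>) x * bessel_I \<nu> x"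

text \<open>
  The entire function \<open>2\<^sup>2\<^sup>\<nu> z\<^sup>-\<^sup>2\<^sup>\<nu>\<^sup>-\<^sup>1 \<Gamma>(\<nu> + 1) \<Gamma>(\<nu> + 2) W\<^sub>\<nu>(z)\<close> is even with value 1 at the origin. On
  the real line it is therefore given by the formula for \<open>z > 0\<close>, applied to \<open>\<bar>x\<bar>\<close>, together with
  that value; lemma \<open>norm_W_eq_series\<close> below exhibits it by power series in \<open>x\<^sup>2\<close>.
\<close>

definition norm_W :: "real \<Rightarrow> real \<Rightarrow> real" where
  "norm_W \<nu> x =
     (if x = 0 then 1
      else 2 powr (2 * \<nu>) * \<bar>x\<bar> powr (- 2 * \<nu> - 1) * Gamma (\<nu> + 1) * Gamma (\<nu> + 2) * cross_W \<nu> \<bar>x\<bar>)"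

text \<open>The \<open>n\<close>-th positive zero in increasing order, counted from \<open>n = 1\<close>.\<close>

definition W_zero :: "real \<Rightarrow> nat \<Rightarrow> real" where
  "W_zero \<nu> n =
     (THE x. 0 < x \<and> cross_W \<nu> x = 0 \<and> card {y. 0 < y \<and> y \<le> x \<and> cross_W \<nu> y = 0} = n)"

text \<open>\<open>rayleigh \<nu> k\<close> is the sum of the \<open>-k\<close>-th powers of the positive zeros.\<close>

definition rayleigh :: "real \<Rightarrow> nat \<Rightarrow> real" where
  "rayleigh \<nu> k = (\<Sum>n. 1 / W_zero \<nu> (Suc n) ^ k)"

definition coeff_B :: "real \<Rightarrow> nat \<Rightarrow> real" where
  "coeff_B \<nu> n = W_zero \<nu> 1 ^ 4 * rayleigh \<nu> (4 * n + 4) - rayleigh \<nu> (4 * n)"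

text \<open>The index \<open>n\<close> counts powers of \<open>x\<^sup>4\<close>: \<open>poly_S \<nu> n\<close> is \<open>S\<^sub>4\<^sub>n\<close>.\<close>

definition poly_S :: "real \<Rightarrow> nat \<Rightarrow> real \<Rightarrow> real" where
  "poly_S \<nu> n x =
     W_zero \<nu> 1 ^ 4 + 16 * pochhammer (\<nu> + 1) 3 * (\<Sum>m=1..n. coeff_B \<nu> m * x ^ (4 * m))"

definition const_r :: "real \<Rightarrow> nat \<Rightarrow> real" where
  "const_r \<nu> n =
     1 / W_zero \<nu> 1 ^ (4 * n + 4) *
     (1 - W_zero \<nu> 1 ^ 4 / (16 * pochhammer (\<nu> + 1) 3)
        - (\<Sum>m=1..n. coeff_B \<nu> m * W_zero \<nu> 1 ^ (4 * m)))"

definition const_s :: "real \<Rightarrow> nat \<Rightarrow> real" where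
  "const_s \<nu> n = coeff_B \<nu> (n + 1)"

definition bound :: "real \<Rightarrow> nat \<Rightarrow> real \<Rightarrow> real \<Rightarrow> real" where
  "bound \<nu> n c x =
     (poly_S \<nu> n x + 16 * pochhammer (\<nu> + 1) 3 * c * x ^ (4 * n + 4)) / (W_zero \<nu> 1 ^ 4 - x ^ 4)"

definition scaled_log_deriv_W :: "real \<Rightarrow> real \<Rightarrow> real" where
  "scaled_log_deriv_W \<nu> x = - (4 * pochhammer (\<nu> + 1) 3 / x ^ 3) * (deriv (norm_W \<nu>) x / norm_W \<nu> x)"


subsection \<open>The second form of the cross-product and the power series of its normalization\<close>

definition clifford :: "real \<Rightarrow> real \<Rightarrow> real" where
  "clifford \<nu> t = (\<Sum>k. 1 / (fact k * Gamma (\<nu> + real k + 1)) * t ^ k)"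

lemma bessel_J_clifford: "bessel_J \<nu> x = (x / 2) powr \<nu> * clifford \<nu> (- ((x / 2)\<^sup>2))"
proof -
  have "(- ((x / 2)\<^sup>2)) ^ k = (-1) ^ k * (x / 2) ^ (2 * k)" for k
    by (metis power_minus power_mult)
  then show ?thesis
    unfolding bessel_J_def clifford_def by (simp add: mult_ac)
qed

lemma bessel_I_clifford: "bessel_I \<nu> x = (x / 2) powr \<nu> * clifford \<nu> ((x / 2)\<^sup>2)"
  unfolding bessel_I_def clifford_def by (simp add: power_mult)

lemma Gamma_step:
  assumes "\<nu> > -1"
  shows "Gamma (\<nu> + real k + 2) = (\<nu> + real k + 1) * Gamma (\<nu> + real k + 1)"
    and "Gamma (\<nu> + real k + 1) > 0"
proof -
  have pos: "\<nu> + real k + 1 > 0"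
    using assms by simp
  then have "\<nu> + real k + 1 \<notin> \<int>\<^sub>\<le>\<^sub>0"
    by (auto elim!: nonpos_Ints_cases)
  then show "Gamma (\<nu> + real k + 2) = (\<nu> + real k + 1) * Gamma (\<nu> + real k + 1)"
    using Gamma_plus1[of "\<nu> + real k + 1"] by (simp add: add.assoc)
  show "Gamma (\<nu> + real k + 1) > 0"
    using pos by (rule Gamma_real_pos)
qed

lemma summable_clifford:
  fixes t :: real
  assumes "\<nu> > -1"
  shows "summable (\<lambda>k. 1 / (fact k * Gamma (\<nu> + real k + 1)) * t ^ k)"
proof -
  define N where "N = nat \<lceil>2 * \<bar>t\<bar> + \<bar>\<nu>\<bar>\<rceil>"
  show ?thesis
  proof (rule summable_ratio_test[of "1 / 2" N])
    fix k assume "N \<le> k"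
    then have kN: "2 * \<bar>t\<bar> + \<bar>\<nu>\<bar> \<le> real k"
      unfolding N_def by linarith
    define G where "G = Gamma (\<nu> + real k + 1)"
    have G: "G > 0" "Gamma (\<nu> + real (Suc k) + 1) = (\<nu> + real k + 1) * G"
      using Gamma_step[OF assms, of k] by (simp_all add: G_def add_ac)
    have d: "(\<nu> + real k + 1) \<ge> 2 * \<bar>t\<bar>" "\<nu> + real k + 1 > 0"
      using kN assms by linarith+
    have "2 * \<bar>t\<bar> * 1 \<le> (\<nu> + real k + 1) * (real k + 1)"
      using d by (intro mult_mono) auto
    then have q: "\<bar>t\<bar> / ((real k + 1) * (\<nu> + real k + 1)) \<le> 1 / 2"
      using d by (subst pos_divide_le_eq) (auto simp: mult.commute)
    have "norm (1 / (fact (Suc k) * Gamma (\<nu> + real (Suc k) + 1)) * t ^ Suc k)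
        = \<bar>t\<bar> / ((real k + 1) * (\<nu> + real k + 1)) * norm (1 / (fact k * G) * t ^ k)"
      unfolding G using G(1) d(2) by (simp add: abs_mult abs_divide power_abs add_ac mult_ac)
    also have "\<dots> \<le> 1 / 2 * norm (1 / (fact k * G) * t ^ k)"
      using q by (rule mult_right_mono) simp
    finally show "norm (1 / (fact (Suc k) * Gamma (\<nu> + real (Suc k) + 1)) * t ^ Suc k)
        \<le> 1 / 2 * norm (1 / (fact k * Gamma (\<nu> + real k + 1)) * t ^ k)"
      by (simp add: G_def)
  qed simp
qed

lemma has_real_derivative_clifford:
  assumes "\<nu> > -1"
  shows "(clifford \<nu> has_real_derivative clifford (\<nu> + 1) t) (at t)"
proof -
  define c where "c = (\<lambda>k. 1 / (fact k * Gamma (\<nu> + real k + 1)))"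
  have "((\<lambda>t. \<Sum>k. c k * t ^ k) has_real_derivative (\<Sum>k. diffs c k * t ^ k)) (at t)"
    unfolding c_def by (rule termdiffs_strong_converges_everywhere) (rule summable_clifford[OF assms])
  moreover have "diffs c k = 1 / (fact k * Gamma (\<nu> + 1 + real k + 1))" for k
  proof -
    have "fact (Suc k) = (real (Suc k)) * fact k"
      by simp
    then have "diffs c k = real (Suc k) * (1 / (real (Suc k) * (fact k * Gamma (\<nu> + real (Suc k) + 1))))"
      unfolding diffs_def c_def by (simp only: mult.assoc)
    also have "\<dots> = 1 / (fact k * Gamma (\<nu> + real (Suc k) + 1))"
      by (simp del: of_nat_Suc)
    finally show ?thesis
      by (simp add: add_ac)
  qed
  ultimately show ?thesis
    by (simp add: clifford_def[abs_def] c_def)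
qed

lemma
  assumes "\<nu> > -1" "x > 0"
  shows has_real_derivative_bessel_J:
      "(bessel_J \<nu> has_real_derivative \<nu> / x * bessel_J \<nu> x - bessel_J (\<nu> + 1) x) (at x)"
    and has_real_derivative_bessel_I:
      "(bessel_I \<nu> has_real_derivative \<nu> / x * bessel_I \<nu> x + bessel_I (\<nu> + 1) x) (at x)"
proof -
  have p: "((\<lambda>x. (x / 2) powr \<nu>) has_real_derivative \<nu> / x * (x / 2) powr \<nu>) (at x)"
    using assms(2) by (auto intro!: derivative_eq_intros simp: powr_diff)
  have q: "((\<lambda>x. s * (x / 2)\<^sup>2) has_real_derivative s * (x / 2)) (at x)" for s
    by (auto intro!: derivative_eq_intros)
  have c: "((\<lambda>x. clifford \<nu> (s * (x / 2)\<^sup>2)) has_real_derivative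
      clifford (\<nu> + 1) (s * (x / 2)\<^sup>2) * (s * (x / 2))) (at x)" for s
    by (rule DERIV_chain2[OF has_real_derivative_clifford[OF assms(1)] q])
  have e: "(x / 2) powr (\<nu> + 1) = (x / 2) powr \<nu> * (x / 2)"
    using assms(2) by (simp add: powr_add)
  show "(bessel_J \<nu> has_real_derivative \<nu> / x * bessel_J \<nu> x - bessel_J (\<nu> + 1) x) (at x)"
    using DERIV_mult[OF p c[of "-1"]]
    by (simp add: bessel_J_clifford[abs_def] e) (simp add: algebra_simps)
  show "(bessel_I \<nu> has_real_derivative \<nu> / x * bessel_I \<nu> x + bessel_I (\<nu> + 1) x) (at x)"
    using DERIV_mult[OF p c[of 1]]
    by (simp add: bessel_I_clifford[abs_def] e) (simp add: algebra_simps)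
qed

lemma cross_W_eq:
  assumes "\<nu> > -1" "x > 0"
  shows "cross_W \<nu> x = bessel_J (\<nu> + 1) x * bessel_I \<nu> x + bessel_J \<nu> x * bessel_I (\<nu> + 1) x"
  unfolding cross_W_def DERIV_imp_deriv[OF has_real_derivative_bessel_J[OF assms]]
    DERIV_imp_deriv[OF has_real_derivative_bessel_I[OF assms]]
  by (simp add: algebra_simps)

lemma norm_W_eq_series:
  assumes "\<nu> > -1"
  shows "norm_W \<nu> x = Gamma (\<nu> + 1) * Gamma (\<nu> + 2) / 2 *
    (clifford (\<nu> + 1) (- (x\<^sup>2 / 4)) * clifford \<nu> (x\<^sup>2 / 4)
     + clifford \<nu> (- (x\<^sup>2 / 4)) * clifford (\<nu> + 1) (x\<^sup>2 / 4))"
proof (cases "x = 0")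
  case True
  have "clifford \<nu> 0 = 1 / Gamma (\<nu> + 1)" for \<nu>
    unfolding clifford_def using powser_zero[of "\<lambda>k. 1 / (fact k * Gamma (\<nu> + real k + 1))"] by simp
  moreover have "Gamma (\<nu> + 1) > 0" "Gamma (\<nu> + 2) > 0"
    using assms by (auto intro!: Gamma_real_pos)
  ultimately show ?thesis
    using True by (simp add: norm_W_def add.assoc)
next
  case False
  define y where "y = \<bar>x\<bar>"
  have y: "y > 0" "(y / 2)\<^sup>2 = x\<^sup>2 / 4"
    using False by (auto simp: y_def power_divide)
  define a where "a = 2 powr (2 * \<nu>) * y powr (- 2 * \<nu> - 1)"
  define b where "b = (y / 2) powr \<nu> * (y / 2) powr (\<nu> + 1)"
  define C where "C = clifford (\<nu> + 1) (- (x\<^sup>2 / 4)) * clifford \<nu> (x\<^sup>2 / 4)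
       + clifford \<nu> (- (x\<^sup>2 / 4)) * clifford (\<nu> + 1) (x\<^sup>2 / 4)"
  have ab: "a * b = 1 / 2"
  proof -
    have "2 powr (2 * \<nu>) * y powr (- 2 * \<nu> - 1) * ((y / 2) powr \<nu> * (y / 2) powr (\<nu> + 1))
        = (2 powr (2 * \<nu>) / 2 powr (2 * \<nu> + 1)) * (y powr (- 2 * \<nu> - 1) * y powr (2 * \<nu> + 1))"
      using y(1) by (simp add: powr_divide flip: powr_add)
    also have "\<dots> = 1 / 2"
    proof -
      have "y powr (- 2 * \<nu> - 1) * y powr (2 * \<nu> + 1) = 1"
        using y(1) by (simp flip: powr_add)
      moreover have "2 powr (2 * \<nu> + 1) = 2 powr (2 * \<nu>) * (2 :: real)"
        by (subst powr_add) simp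
      ultimately show ?thesis
        by simp
    qed
    finally show ?thesis
      by (simp add: a_def b_def)
  qed
  have W: "cross_W \<nu> y = b * C"
    unfolding cross_W_eq[OF assms y(1)] bessel_J_clifford bessel_I_clifford y(2) b_def C_def
    by (simp add: algebra_simps)
  have "norm_W \<nu> x = a * Gamma (\<nu> + 1) * Gamma (\<nu> + 2) * (b * C)"
    using False by (simp add: norm_W_def a_def W flip: y_def)
  also have "\<dots> = (a * b) * (Gamma (\<nu> + 1) * Gamma (\<nu> + 2) * C)"
    by (simp only: mult_ac)
  finally show ?thesis
    by (simp add: ab C_def)
qed

end

theory Submission
  imports Defs
    "HOL-Complex_Analysis.Great_Picard"
    "HOL-Computational_Algebra.Fundamental_Theorem_Algebra"
begin

text \<open>
  In the variable \<open>t = x\<^sup>4\<close> the function \<open>norm_W \<nu>\<close> is the power series \<open>F\<close> with coefficients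
  \<open>(-1)\<^sup>k / (16\<^sup>k k! (\<nu> + 1)\<^sub>k (\<nu> + 2)\<^sub>2\<^sub>k)\<close>. This is a limit of polynomials obtained from \<open>(1 - s t)\<^sup>N\<close> by
  operators \<open>p \<mapsto> p + t p' / \<alpha>\<close> with \<open>\<alpha> > 0\<close>, which keep all roots real and positive. The reciprocal
  roots, in decreasing order, are bounded by a constant times \<open>1 / i\<^sup>2\<close>, so along a subsequence the
  product representations converge and \<open>- F' / F = (\<Sum>i. \<mu>\<^sub>i / (1 - \<mu>\<^sub>i t))\<close>, where the \<open>1 / \<mu>\<^sub>i\<close> are
  the zeros of \<open>F\<close>. The zeros are simple, because \<open>(x W\<^sub>\<nu>)' = 2 x J\<^sub>\<nu> I\<^sub>\<nu>\<close> turns a double zero into a common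
  zero of \<open>J\<^sub>\<nu>\<close> and \<open>J\<^bsub>\<nu>+1\<^esub>\<close>. Splitting off \<open>n\<close> terms of the geometric series, the bounds of the
  theorem become bounds for the remainder
  \<open>(\<Sum>i. (\<mu>\<^sub>i / \<mu>\<^sub>0 - 1) \<mu>\<^sub>i\<^bsup>n+1\<^esup> / (1 - \<mu>\<^sub>i t))\<close>,
  which decreases from \<open>s\<close> at \<open>t = 0\<close> to \<open>r\<close> at \<open>t = 1 / \<mu>\<^sub>0\<close>.
\<close>

subsection \<open>Polynomials with positive roots\<close>

text \<open>Stated over the complex numbers, where the polynomial splits into linear factors and no
  root is missed.\<close>

definition pos_rooted :: "complex poly \<Rightarrow> bool" where
  "pos_rooted p \<longleftrightarrow> p \<noteq> 0 \<and> (\<forall>z. poly p z = 0 \<longrightarrow> z \<in> \<real> \<and> 0 < Re z)"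

text \<open>The logarithmic derivative of a product, cleared of denominators. It turns a root of an
  Euler transform into an equation for a sum over the old roots.\<close>

lemma pderiv_prod_linear:
  fixes z :: complex and n :: nat
  assumes "\<And>i. i < n \<Longrightarrow> z \<noteq> r i"
  shows "poly (pderiv (\<Prod>i<n. [:- r i, 1:])) z
    = poly (\<Prod>i<n. [:- r i, 1:]) z * (\<Sum>i<n. 1 / (z - r i))"
  using assms
proof (induction n)
  case (Suc n)
  let ?g = "\<Prod>i<n. [:- r i, 1:]"
  have "poly (pderiv (\<Prod>i<Suc n. [:- r i, 1:])) z
      = poly ?g z + (z - r n) * (poly ?g z * (\<Sum>i<n. 1 / (z - r i)))"
    unfolding prod.lessThan_Suc pderiv_mult using Suc by (simp add: pderiv_pCons algebra_simps)
  also have "\<dots> = (z - r n) * poly ?g z * ((\<Sum>i<n. 1 / (z - r i)) + 1 / (z - r n))"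
    using Suc.prems[of n] by (simp add: field_simps)
  finally show ?case
    by (simp add: algebra_simps)
qed simp

text \<open>
  A root \<open>z\<close> of the new polynomial that is no root of \<open>p\<close> satisfies \<open>(\<Sum>i. z / (z - r\<^sub>i)) = - a\<close>; each
  summand has imaginary part of the sign of \<open>- Im z\<close>, and is nonnegative for \<open>z \<le> 0\<close>.
\<close>

lemma pos_rooted_euler:
  assumes p: "pos_rooted p" and a: "a > 0"
  shows "pos_rooted (p + smult (of_real (1 / a)) (pCons 0 (pderiv p)))" (is "pos_rooted ?q")
proof -
  have p0: "poly p 0 \<noteq> 0"
    using p by (auto simp: pos_rooted_def)
  have "poly ?q 0 \<noteq> 0"
    using p0 by simp
  then have q0: "?q \<noteq> 0"
    by (metis poly_0)
  moreover have "z \<in> \<real> \<and> 0 < Re z" if z: "poly ?q z = 0" for z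
  proof (cases "poly p z = 0")
    case True
    then show ?thesis
      using p by (simp add: pos_rooted_def)
  next
    case False
    obtain r where r: "smult (lead_coeff p) (\<Prod>i<degree p. [:- r i, 1:]) = p"
      by (rule complex_poly_decompose')
    define n where "n = degree p"
    define g where "g = (\<Prod>i<n. [:- r i, 1:])"
    have pg: "p = smult (lead_coeff p) g"
      using r by (simp add: g_def n_def)
    have lc: "lead_coeff p \<noteq> 0"
      using p by (simp add: pos_rooted_def)
    have rroot: "poly g (r i) = 0" if "i < n" for i
      unfolding g_def poly_prod using that by (intro prod_zero) auto
    have rpos: "r i \<in> \<real>" "0 < Re (r i)" if "i < n" for i
    proof -
      have "poly p (r i) = 0"
        by (subst pg) (simp add: rroot[OF that])
      then show "r i \<in> \<real>" "0 < Re (r i)"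
        using p by (auto simp: pos_rooted_def)
    qed
    have gz: "poly g z \<noteq> 0"
      using False by (metis pg mult_zero_right poly_smult)
    then have zr: "z \<noteq> r i" if "i < n" for i
      using rroot[OF that] by auto
    have "poly p z + of_real (1 / a) * (z * poly (pderiv p) z) = 0"
      using z by simp
    moreover have "poly p z = lead_coeff p * poly g z"
      by (subst pg) simp
    moreover have "poly (pderiv p) z = lead_coeff p * (poly g z * (\<Sum>i<n. 1 / (z - r i)))"
      by (subst pg) (simp add: pderiv_smult g_def pderiv_prod_linear[OF zr])
    ultimately have "lead_coeff p * poly g z * (1 + of_real (1 / a) * (\<Sum>i<n. z / (z - r i))) = 0"
      by (simp add: algebra_simps sum_distrib_left)
    then have "1 + of_real (1 / a) * (\<Sum>i<n. z / (z - r i)) = 0"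
      using lc gz by simp
    then have S: "(\<Sum>i<n. z / (z - r i)) = - of_real a"
      using a by (simp add: field_simps add_eq_0_iff)
    have n0: "n > 0"
    proof (rule ccontr)
      assume "\<not> n > 0"
      then show False
        using S a by simp
    qed
    have zr2: "(cmod (z - r i))\<^sup>2 > 0" if "i < n" for i
      using zr[OF that] by simp
    have Imi: "Im (z / (z - r i)) = - (Re (r i) / (cmod (z - r i))\<^sup>2) * Im z"
      and Rei: "Re (z / (z - r i)) = ((cmod z)\<^sup>2 - Re z * Re (r i)) / (cmod (z - r i))\<^sup>2"
      if "i < n" for i
    proof -
      have "Im (r i) = 0"
        using rpos(1)[OF that] by (simp add: complex_is_Real_iff)
      moreover from this have "Re z = Re (r i) \<longrightarrow> Im z \<noteq> 0"
        using zr2[OF that] by (auto simp: cmod_power2)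
      ultimately show "Im (z / (z - r i)) = - (Re (r i) / (cmod (z - r i))\<^sup>2) * Im z"
        "Re (z / (z - r i)) = ((cmod z)\<^sup>2 - Re z * Re (r i)) / (cmod (z - r i))\<^sup>2"
        by (simp_all add: Re_divide Im_divide cmod_power2 field_simps)
          (simp_all add: power2_eq_square algebra_simps)
    qed
    have "(\<Sum>i<n. - (Re (r i) / (cmod (z - r i))\<^sup>2) * Im z) = 0"
      using arg_cong[OF S, of Im] by (simp add: Imi)
    then have "(\<Sum>i<n. (Re (r i) / (cmod (z - r i))\<^sup>2)) * Im z = 0"
      by (simp add: sum_negf sum_distrib_right)
    moreover have "(\<Sum>i<n. (Re (r i) / (cmod (z - r i))\<^sup>2)) > 0"
      using n0 rpos zr2 by (intro sum_pos) auto
    ultimately have Imz: "Im z = 0"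
      by simp
    moreover have "Re z > 0"
    proof (rule ccontr)
      assume "\<not> Re z > 0"
      then have "Re z * Re (r i) \<le> (cmod z)\<^sup>2" if "i < n" for i
        using rpos(2)[OF that] by (meson mult_nonpos_nonneg less_imp_le not_less order_trans zero_le_power2)
      then have "(\<Sum>i<n. Re (z / (z - r i))) \<ge> 0"
        by (intro sum_nonneg) (auto simp: Rei intro!: divide_nonneg_nonneg)
      moreover have "(\<Sum>i<n. Re (z / (z - r i))) = - a"
        using arg_cong[OF S, of Re] by simp
      ultimately show False
        using a by simp
    qed
    ultimately show ?thesis
      by (simp add: complex_is_Real_iff)
  qed
  ultimately show ?thesis
    unfolding pos_rooted_def by blast
qed

text \<open>The Euler operator is diagonal on monomials, so composing such operators multiplies the
  coefficients by products of linear functions of \<open>k\<close>.\<close>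

lemma coeff_euler:
  "coeff (p + smult c (pCons 0 (pderiv p))) k = (1 + of_nat k * c) * coeff p k"
  by (cases k) (auto simp: coeff_pCons coeff_pderiv algebra_simps)

lemma pos_rooted_multiplier:
  fixes N :: nat
  assumes "pos_rooted p" "\<And>j. j < N \<Longrightarrow> 0 < a j"
  obtains q where "pos_rooted q"
    "\<And>k. coeff q k = of_real (\<Prod>j<N. 1 + real k / a j) * coeff p k"
proof -
  have "\<exists>q. pos_rooted q \<and> (\<forall>k. coeff q k = of_real (\<Prod>j<N. 1 + real k / a j) * coeff p k)"
    using assms(2)
  proof (induction N)
    case 0
    then show ?case
      using assms(1) by auto
  next
    case (Suc N)
    then obtain q where q: "pos_rooted q"
      "\<And>k. coeff q k = of_real (\<Prod>j<N. 1 + real k / a j) * coeff p k"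
      by auto
    have "coeff (q + smult (of_real (1 / a N)) (pCons 0 (pderiv q))) k =
        of_real (\<Prod>j<Suc N. 1 + real k / a j) * coeff p k" for k
      unfolding coeff_euler q(2) by simp
    then show ?case
      using pos_rooted_euler[OF q(1), of "a N"] Suc.prems by blast
  qed
  then show ?thesis
    using that by blast
qed

lemma pos_rooted_power_linear:
  assumes "s > 0"
  shows "pos_rooted ([:1, - of_real s:] ^ N)"
proof -
  have "z = of_real (1 / s)" if "1 = z * of_real s" for z :: complex
    using that assms by (simp add: field_simps)
  then have "z \<in> \<real> \<and> 0 < Re z" if "1 = z * of_real s" for z :: complex
    using that assms by (metis Reals_of_real Re_complex_of_real zero_less_divide_1_iff)
  then show ?thesis
    by (auto simp: pos_rooted_def)
qed

lemma coeff_power_linear: "coeff ([:1, s:] ^ N) k = of_nat (N choose k) * s ^ k"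
  for s :: "'a::comm_ring_1"
proof (cases "k \<le> N")
  case True
  then show ?thesis
    by (simp add: coeff_linear_poly_power)
next
  case False
  have "degree ([:1, s:] ^ N) \<le> 1 * N"
    by (rule order_trans[OF degree_power_le]) (simp add: mult_le_mono1)
  then show ?thesis
    using False by (simp add: coeff_eq_0 binomial_eq_0)
qed

section \<open>Reciprocal roots and elementary symmetric functions\<close>

text \<open>Constant term 1 means that the reciprocal roots determine the polynomial. They are
  sorted decreasingly and padded by zeros, each contributing the factor 1, to reach the prescribed
  number \<open>N\<close> of factors.\<close>

lemma pos_rooted_factorization:
  assumes p: "pos_rooted p" and p0: "poly p 0 = 1" and N: "degree p \<le> N"
  obtains m :: "nat \<Rightarrow> real" where "antimono m" "\<And>i. 0 \<le> m i" "\<And>i. N \<le> i \<Longrightarrow> m i = 0"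
    "p = (\<Prod>i<N. [:1, - of_real (m i):])"
proof -
  define n where "n = degree p"
  obtain r where "smult (lead_coeff p) (\<Prod>i<degree p. [:- r i, 1:]) = p"
    by (rule complex_poly_decompose')
  then have r: "p = smult (lead_coeff p) (\<Prod>i<n. [:- r i, 1:])"
    by (simp add: n_def)
  have rpos: "r i = of_real (Re (r i))" "0 < Re (r i)" if "i < n" for i
  proof -
    have "poly (\<Prod>i<n. [:- r i, 1:]) (r i) = 0"
      unfolding poly_prod using that by (intro prod_zero) auto
    then have "poly p (r i) = 0"
      by (subst r) simp
    then have "r i \<in> \<real>" "0 < Re (r i)"
      using p by (auto simp: pos_rooted_def)
    then show "r i = of_real (Re (r i))" "0 < Re (r i)"
      by simp_all
  qed
  define xs where "xs = rev (sort (map (\<lambda>i. 1 / Re (r i)) [0..<n]))"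
  define m where "m = (\<lambda>i. if i < n then xs ! i else 0)"
  have len: "length xs = n"
    by (simp add: xs_def)
  have xs0: "0 \<le> xs ! i" if "i < n" for i
  proof -
    have "xs ! i \<in> set xs"
      using that len by simp
    then show ?thesis
      using rpos(2) by (auto simp: xs_def less_imp_le)
  qed
  have "antimono m"
  proof (rule antimonoI)
    fix i j :: nat assume "i \<le> j"
    moreover have "xs ! j \<le> xs ! i" if "j < n"
    proof -
      have "sorted_wrt (\<ge>) xs"
        unfolding xs_def by (simp add: sorted_wrt_rev)
      then show ?thesis
        using that \<open>i \<le> j\<close> len by (cases "i = j") (auto simp: sorted_wrt_iff_nth_less)
    qed
    ultimately show "m j \<le> m i"
      using xs0 by (auto simp: m_def)
  qed
  \<comment> \<open>Each factor is written as \<open>z - r = - r * (1 - z / r)\<close>; the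
    collected scalars times the leading coefficient give \<open>poly p 0\<close>, which is
    1.\<close>
  have "(\<Prod>i<n. [:- r i, 1:]) = (\<Prod>i<n. smult (- r i) [:1, - of_real (1 / Re (r i)):])"
  proof (rule prod.cong[OF refl])
    fix i assume "i \<in> {..<n}"
    then obtain x where x: "r i = of_real x" "x \<noteq> 0"
      using rpos[of i] by (metis lessThan_iff less_irrefl)
    show "[:- r i, 1:] = smult (- r i) [:1, - of_real (1 / Re (r i)):]"
      unfolding x(1) using x(2) by simp
  qed
  also have "\<dots> = smult (\<Prod>i<n. - r i) (\<Prod>i<n. [:1, - of_real (1 / Re (r i)):])"
    by (rule prod_smult)
  also have "(\<Prod>i<n. [:1, - of_real (1 / Re (r i)) :: complex:]) = (\<Prod>x\<leftarrow>xs. [:1, - of_real x:])"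
  proof -
    have "(\<Prod>x\<leftarrow>xs. [:1, - of_real x :: complex:])
        = (\<Prod>x\<leftarrow>map (\<lambda>i. 1 / Re (r i)) [0..<n]. [:1, - of_real x:])"
      unfolding prod_mset_prod_list[symmetric] mset_map xs_def by simp
    then show ?thesis
      using prod.distinct_set_conv_list[of "[0..<n]" "\<lambda>i. [:1, - of_real (1 / Re (r i)) :: complex:]"]
      by (simp add: o_def atLeast0LessThan)
  qed
  also have "\<dots> = (\<Prod>i<n. [:1, - of_real (m i):])"
    by (subst prod.list_conv_set_nth) (simp add: len m_def atLeast0LessThan)
  also have "\<dots> = (\<Prod>i<N. [:1, - of_real (m i):])"
    using N by (intro prod.mono_neutral_left) (auto simp: m_def n_def)
  finally have e: "p = smult (lead_coeff p * (\<Prod>i<n. - r i)) (\<Prod>i<N. [:1, - of_real (m i):])"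
    using r by simp
  have "poly p 0 = lead_coeff p * (\<Prod>i<n. - r i)"
    by (subst e) (simp add: poly_prod)
  then have "p = (\<Prod>i<N. [:1, - of_real (m i):])"
    using e p0 by simp
  moreover have "m i = 0" if "N \<le> i" for i
    using that N by (simp add: m_def n_def)
  moreover have "0 \<le> m i" for i
    using xs0 by (simp add: m_def)
  ultimately show ?thesis
    using that \<open>antimono m\<close> by blast
qed

text \<open>Coefficient \<open>k\<close> is the elementary symmetric function of degree
  \<open>k\<close> in the first \<open>n\<close> entries: a sum of nonnegative products, one of
  which is the product of the first \<open>k\<close> entries.\<close>

lemma coeff_prod_linear_ge:
  fixes m :: "nat \<Rightarrow> real"
  assumes "\<And>i. 0 \<le> m i"
  shows "0 \<le> coeff (\<Prod>i<n. [:1, m i:]) k"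
    and "k \<le> n \<Longrightarrow> (\<Prod>i<k. m i) \<le> coeff (\<Prod>i<n. [:1, m i:]) k"
proof -
  \<comment> \<open>A \<open>k\<close>-element index set either omits the last index
    \<open>n\<close> or contains it.\<close>
  have step: "coeff (\<Prod>i<Suc n. [:1, m i:]) k
      = coeff (\<Prod>i<n. [:1, m i:]) k + m n * (if k = 0 then 0 else coeff (\<Prod>i<n. [:1, m i:]) (k - 1))" for n k
    by (simp add: mult.commute[of _ "[:1, _:]"] coeff_pCons split: nat.split)
  have nonneg: "0 \<le> coeff (\<Prod>i<n. [:1, m i:]) k" for n k
  proof (induction n arbitrary: k)
    case (Suc n)
    then show ?case
      unfolding step using assms by (auto intro!: add_nonneg_nonneg mult_nonneg_nonneg)
  qed (simp add: coeff_pCons split: nat.split)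
  then show "0 \<le> coeff (\<Prod>i<n. [:1, m i:]) k" .
  show "(\<Prod>i<k. m i) \<le> coeff (\<Prod>i<n. [:1, m i:]) k" if "k \<le> n"
    using that
  proof (induction n arbitrary: k)
    case (Suc n)
    show ?case
    proof (cases "k = Suc n")
      case True
      then show ?thesis
        unfolding step using Suc.IH[of n] nonneg[of n k] assms[of n]
        by (simp add: mult.commute mult_left_mono add_increasing)
    next
      case False
      then show ?thesis
        unfolding step using Suc.IH[of k] Suc.prems nonneg[of n "k - 1"] assms[of n]
        by (auto intro: add_increasing2)
    qed
  qed (simp add: coeff_pCons)
qed

subsection \<open>Limits of products with summable reciprocal zeros\<close>

text \<open>Row \<open>N\<close> holds the reciprocal roots of the \<open>N\<close>-th approximating
  polynomial. The summable majorant \<open>b\<close>, common to all rows, lets limits pass through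
  sums and products.\<close>

locale product_limit =
  fixes m :: "nat \<Rightarrow> nat \<Rightarrow> real" and d :: "nat \<Rightarrow> nat" and b \<mu> :: "nat \<Rightarrow> real"
    and F :: "real \<Rightarrow> real"
  assumes antimono_m: "antimono (m N)"
    and m_nonneg: "0 \<le> m N i"
    and m_zero: "d N \<le> i \<Longrightarrow> m N i = 0"
    and m_le: "m N i \<le> b i"
    and summable_b: "summable b"
    and m_lim: "(\<lambda>N. m N i) \<longlonglongrightarrow> \<mu> i"
    and F_lim: "(\<lambda>N. \<Prod>i<d N. 1 - m N i * t) \<longlonglongrightarrow> F t"
begin

lemma \<mu>_nonneg: "0 \<le> \<mu> i"
  by (rule LIMSEQ_le_const[OF m_lim]) (use m_nonneg in auto)

lemma \<mu>_le: "\<mu> i \<le> b i"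
  by (rule LIMSEQ_le_const2[OF m_lim]) (use m_le in auto)

lemma \<mu>_antimono: "i \<le> j \<Longrightarrow> \<mu> j \<le> \<mu> i"
  by (rule LIMSEQ_le[OF m_lim m_lim]) (use antimono_m in \<open>auto dest: antimonoD\<close>)

lemma summable_\<mu>: "summable \<mu>"
  by (rule summable_comparison_test'[OF summable_b]) (use \<mu>_nonneg \<mu>_le in auto)

lemma b_nonneg: "0 \<le> b i"
  using \<mu>_nonneg \<mu>_le order_trans by blast

lemma suminf_m_lim: "(\<lambda>N. \<Sum>i. m N i) \<longlonglongrightarrow> (\<Sum>i. \<mu> i)"
proof -
  have "\<forall>\<^sub>F (i, N) in at_top \<times>\<^sub>F sequentially. norm (m N i) \<le> b i"
    using m_nonneg m_le by (intro always_eventually) auto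
  then show ?thesis
    using tannerys_theorem[of "\<lambda>i N. m N i" \<mu> sequentially b] m_lim summable_b by simp
qed

text \<open>Outside \<open>A\<close> the factors are estimated by \<open>1 + x \<le> exp x\<close>,
  and the resulting bound survives the limit. Suitable finite sets \<open>A\<close> exhibit zeros,
  double zeros, and polynomial growth when only finitely many \<open>\<mu> i\<close> are
  nonzero.\<close>

lemma F_bound:
  assumes "finite A"
  shows "\<bar>F t\<bar> \<le> (\<Prod>i\<in>A. \<bar>1 - \<mu> i * t\<bar>) * exp (((\<Sum>i. \<mu> i) - (\<Sum>i\<in>A. \<mu> i)) * \<bar>t\<bar>)"
proof (rule LIMSEQ_le[OF tendsto_rabs[OF F_lim]])
  show "(\<lambda>N. (\<Prod>i\<in>A. \<bar>1 - m N i * t\<bar>) * exp (((\<Sum>i. m N i) - (\<Sum>i\<in>A. m N i)) * \<bar>t\<bar>))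
      \<longlonglongrightarrow> (\<Prod>i\<in>A. \<bar>1 - \<mu> i * t\<bar>) * exp (((\<Sum>i. \<mu> i) - (\<Sum>i\<in>A. \<mu> i)) * \<bar>t\<bar>)"
    by (intro tendsto_intros m_lim suminf_m_lim)
  have "\<bar>\<Prod>i<d N. 1 - m N i * t\<bar> \<le> (\<Prod>i\<in>A. \<bar>1 - m N i * t\<bar>)
      * exp (((\<Sum>i. m N i) - (\<Sum>i\<in>A. m N i)) * \<bar>t\<bar>)" for N
  proof -
    \<comment> \<open>\<open>A\<close> may contain indices beyond \<open>d N\<close>, where row
      \<open>N\<close> vanishes; enlarging the range adds only factors 1.\<close>
    define I where "I = {..<d N} \<union> A"
    have I: "finite I" "A \<subseteq> I"
      using assms by (auto simp: I_def)
    have "(\<Sum>i. m N i) = (\<Sum>i\<in>I. m N i)"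
      by (rule suminf_finite[OF I(1)]) (use m_zero in \<open>auto simp: I_def\<close>)
    then have S: "(\<Sum>i. m N i) - (\<Sum>i\<in>A. m N i) = (\<Sum>i\<in>I - A. m N i)"
      using I by (simp add: sum_diff)
    have "\<bar>\<Prod>i<d N. 1 - m N i * t\<bar> = (\<Prod>i<d N. \<bar>1 - m N i * t\<bar>)"
      by (rule abs_prod)
    also have "\<dots> = (\<Prod>i\<in>I. \<bar>1 - m N i * t\<bar>)"
      by (rule prod.mono_neutral_left) (use I m_zero in \<open>auto simp: I_def\<close>)
    also have "\<dots> = (\<Prod>i\<in>A. \<bar>1 - m N i * t\<bar>) * (\<Prod>i\<in>I - A. \<bar>1 - m N i * t\<bar>)"
      using I by (simp add: prod.subset_diff mult.commute)
    also have "(\<Prod>i\<in>I - A. \<bar>1 - m N i * t\<bar>) \<le> (\<Prod>i\<in>I - A. exp (m N i * \<bar>t\<bar>))"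
    proof (rule prod_mono, safe)
      fix i
      have "\<bar>1 - m N i * t\<bar> \<le> 1 + m N i * \<bar>t\<bar>"
        using m_nonneg[of N i] by (metis abs_mult abs_of_nonneg abs_one abs_triangle_ineq4)
      also have "\<dots> \<le> exp (m N i * \<bar>t\<bar>)"
        by (rule exp_ge_add_one_self)
      finally show "\<bar>1 - m N i * t\<bar> \<le> exp (m N i * \<bar>t\<bar>)" .
    qed simp
    also have "\<dots> = exp ((\<Sum>i\<in>I - A. m N i) * \<bar>t\<bar>)"
      using I by (simp add: exp_sum sum_distrib_right)
    finally show ?thesis
      unfolding S by (simp add: mult_left_mono prod_nonneg)
  qed
  then show "\<exists>M. \<forall>N\<ge>M. \<bar>\<Prod>i<d N. 1 - m N i * t\<bar> \<le> (\<Prod>i\<in>A. \<bar>1 - m N i * t\<bar>)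
      * exp (((\<Sum>i. m N i) - (\<Sum>i\<in>A. m N i)) * \<bar>t\<bar>)"
    by blast
qed

text \<open>A uniform tail estimate keeps the limit from acquiring new zeros: the factors beyond
  some \<open>k\<close> that does not depend on \<open>N\<close> multiply to at least 1/2, so half
  the modulus of the first \<open>k\<close> limit factors bounds \<open>F t\<close> from
  below.\<close>

lemma F_nonzero:
  assumes t: "0 \<le> t" and nz: "\<And>i. \<mu> i * t \<noteq> 1"
  shows "F t \<noteq> 0"
proof -
  have "(\<lambda>k. (\<Sum>i. b (i + k)) * t) \<longlonglongrightarrow> 0 * t"
    by (intro tendsto_intros suminf_exist_split2 summable_b)
  then have "\<forall>\<^sub>F k in sequentially. (\<Sum>i. b (i + k)) * t < 1 / 2"
    by (rule order_tendstoD) simp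
  then obtain k where k: "(\<Sum>i. b (i + k)) * t < 1 / 2"
    by (meson eventually_sequentially order_refl)
  have tail: "1 / 2 \<le> (\<Prod>i\<in>{k..<l}. 1 - m N i * t)" for N l
  proof -
    have bs: "summable (\<lambda>i. b (i + k))"
      using summable_b by (simp add: summable_iff_shift)
    have fin: "(\<Sum>i\<in>A. b (i + k) * t) \<le> 1 / 2" if "finite A" for A
    proof -
      have "(\<Sum>i\<in>A. b (i + k)) \<le> (\<Sum>i. b (i + k))"
        by (rule sum_le_suminf[OF bs that]) (use b_nonneg in auto)
      then show ?thesis
        using mult_right_mono[OF _ t] k by (fastforce simp flip: sum_distrib_right)
    qed
    have mb: "m N i * t \<le> b i * t" for i
      using m_le t by (rule mult_right_mono)
    have "(\<Sum>i\<in>{k..<l}. m N i * t) \<le> (\<Sum>i\<in>{k..<l}. b i * t)"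
      using mb by (rule sum_mono)
    also have "\<dots> \<le> 1 / 2"
    proof (cases "k \<le> l")
      case True
      then have "{k..<l} = (\<lambda>i. i + k) ` {..<l - k}"
        by (simp add: lessThan_atLeast0 add.commute[of _ k] image_add_atLeastLessThan)
      then have "(\<Sum>i\<in>{k..<l}. b i * t) = (\<Sum>i<l - k. b (i + k) * t)"
        by (simp add: sum.reindex)
      then show ?thesis
        using fin[of "{..<l - k}"] by simp
    qed simp
    finally have S: "(\<Sum>i\<in>{k..<l}. m N i * t) \<le> 1 / 2" .
    have "m N i * t \<in> {0..1}" if "i \<in> {k..<l}" for i
      using mb[of i] fin[of "{i - k}"] that m_nonneg[of N i] t by auto
    \<comment> \<open>For numbers in [0, 1] the product of all \<open>1 - x\<close> is at least 1
      minus their sum.\<close>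
    from Weierstrass_prod_ineq[of "{k..<l}" "\<lambda>i. m N i * t", OF this] S show ?thesis
      by simp
  qed
  have Qge: "\<bar>\<Prod>i<k. 1 - m N i * t\<bar> / 2 \<le> \<bar>\<Prod>i<d N. 1 - m N i * t\<bar>" for N
  proof -
    have "(\<Prod>i<d N. 1 - m N i * t) = (\<Prod>i<max (d N) k. 1 - m N i * t)"
      by (rule prod.mono_neutral_left) (use m_zero in auto)
    also have "{..<max (d N) k} = {..<k} \<union> {k..<max (d N) k}"
      by auto
    also have "(\<Prod>i\<in>\<dots>. 1 - m N i * t)
        = (\<Prod>i<k. 1 - m N i * t) * (\<Prod>i\<in>{k..<max (d N) k}. 1 - m N i * t)"
      by (rule prod.union_disjoint) auto
    finally have e: "\<bar>\<Prod>i<d N. 1 - m N i * t\<bar>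
        = \<bar>\<Prod>i<k. 1 - m N i * t\<bar> * \<bar>\<Prod>i\<in>{k..<max (d N) k}. 1 - m N i * t\<bar>"
      by (simp add: abs_mult)
    show ?thesis
      unfolding e using mult_left_mono[OF order_trans[OF tail[of N "max (d N) k"] abs_ge_self],
        of "\<bar>\<Prod>i<k. 1 - m N i * t\<bar>"]
      by simp
  qed
  have "\<bar>\<Prod>i<k. 1 - \<mu> i * t\<bar> / 2 \<le> \<bar>F t\<bar>"
  proof (rule LIMSEQ_le[OF _ tendsto_rabs[OF F_lim]])
    show "(\<lambda>N. \<bar>\<Prod>i<k. 1 - m N i * t\<bar> / 2) \<longlonglongrightarrow> \<bar>\<Prod>i<k. 1 - \<mu> i * t\<bar> / 2"
      by (intro tendsto_intros m_lim)  simp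
  qed (use Qge in blast)
  moreover have "(\<Prod>i<k. 1 - \<mu> i * t) \<noteq> 0"
    using nz by auto
  ultimately show ?thesis
    by auto
qed

lemma F_eq_0_iff:
  assumes "0 \<le> t"
  shows "F t = 0 \<longleftrightarrow> (\<exists>i. \<mu> i * t = 1)"
proof
  assume "\<exists>i. \<mu> i * t = 1"
  then obtain i where "\<mu> i * t = 1" ..
  then show "F t = 0"
    using F_bound[of "{i}" t] by simp
qed (use F_nonzero[OF assms] in blast)

text \<open>Keeping both factors \<open>i\<close> and \<open>j\<close> in \<open>F_bound\<close>
  makes \<open>F x\<close> at most \<open>(1 - x / t)\<^sup>2\<close> times a locally bounded
  exponential, so the difference quotient at \<open>t\<close> tends to 0.\<close>

lemma double_zero:
  assumes "i \<noteq> j" "\<mu> i = \<mu> j" "\<mu> i * t = 1" and der: "(F has_real_derivative D) (at t)"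
  shows "D = 0"
proof -
  have t: "t \<noteq> 0" "\<mu> i = 1 / t" "\<mu> j = 1 / t"
    using assms(2,3) by (auto simp: eq_divide_eq)
  have F0: "F t = 0"
    using F_bound[of "{i}" t] assms by simp
  define c where "c = (\<Sum>i. \<mu> i) - (\<mu> i + \<mu> j)"
  have bound: "\<bar>F x\<bar> \<le> (1 - x / t)\<^sup>2 * exp (c * \<bar>x\<bar>)" for x
    using F_bound[of "{i, j}" x] assms(1,2) t by (simp add: c_def power2_eq_square abs_mult)
  have "((\<lambda>x. \<bar>x - t\<bar> / t\<^sup>2 * exp (c * \<bar>x\<bar>)) \<longlongrightarrow> \<bar>t - t\<bar> / t\<^sup>2 * exp (c * \<bar>t\<bar>)) (at t)"
    using t by (intro tendsto_intros) auto
  then have lim0: "((\<lambda>x. \<bar>x - t\<bar> / t\<^sup>2 * exp (c * \<bar>x\<bar>)) \<longlongrightarrow> 0) (at t)"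
    by simp
  have "((\<lambda>x. F x / (x - t)) \<longlongrightarrow> 0) (at t)"
  proof (rule Lim_null_comparison[OF _ lim0])
    show "\<forall>\<^sub>F x in at t. norm (F x / (x - t)) \<le> \<bar>x - t\<bar> / t\<^sup>2 * exp (c * \<bar>x\<bar>)"
    proof (rule eventually_at_topological[THEN iffD2], intro exI[of _ UNIV] conjI ballI impI)
      fix x assume "x \<noteq> t"
      have e: "(1 - x / t)\<^sup>2 * exp (c * \<bar>x\<bar>) = \<bar>x - t\<bar> * (\<bar>x - t\<bar> / t\<^sup>2 * exp (c * \<bar>x\<bar>))"
        using t(1) by (simp add: power2_eq_square divide_simps) (simp add: algebra_simps)
      have "\<bar>F x\<bar> \<le> \<bar>x - t\<bar> * (\<bar>x - t\<bar> / t\<^sup>2 * exp (c * \<bar>x\<bar>))"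
        using bound[of x] unfolding e .
      then show "norm (F x / (x - t)) \<le> \<bar>x - t\<bar> / t\<^sup>2 * exp (c * \<bar>x\<bar>)"
        using \<open>x \<noteq> t\<close> by (simp add: abs_divide pos_divide_le_eq mult.commute)
    qed auto
  qed
  moreover have "((\<lambda>x. F x / (x - t)) \<longlongrightarrow> D) (at t)"
    using der F0 by (simp add: has_field_derivative_iff)
  ultimately show ?thesis
    by (simp add: tendsto_unique[OF trivial_limit_at])
qed

end

lemma has_real_derivative_prod_linear:
  fixes m :: "nat \<Rightarrow> real"
  assumes "\<And>i. i < n \<Longrightarrow> m i * t \<noteq> 1"
  shows "((\<lambda>t. \<Prod>i<n. 1 - m i * t) has_real_derivative
    - (\<Prod>i<n. 1 - m i * t) * (\<Sum>i<n. m i / (1 - m i * t))) (at t)"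
  using assms
proof (induction n)
  case (Suc n)
  let ?P = "\<Prod>i<n. 1 - m i * t" and ?S = "\<Sum>i<n. m i / (1 - m i * t)"
  have "((\<lambda>t. (\<Prod>i<n. 1 - m i * t) * (1 - m n * t)) has_real_derivative
      - ?P * ?S * (1 - m n * t) + - m n * ?P) (at t)"
    by (rule DERIV_mult[OF Suc.IH]) (use Suc.prems in \<open>auto intro!: derivative_eq_intros\<close>)
  moreover have "m n * t \<noteq> 1"
    using Suc.prems by simp
  then have "- ?P * ?S * (1 - m n * t) + - m n * ?P
      = - (?P * (1 - m n * t)) * (?S + m n / (1 - m n * t))"
    by (simp add: field_simps)
  ultimately show ?case
    by simp
qed simp

text \<open>Both sides are limits of the logarithmic derivatives of the approximating products: the
  left one by dominated convergence of the partial fractions, the right one because the products and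
  their derivatives converge.\<close>

lemma (in product_limit) log_derivative:
  assumes t: "0 \<le> t" "\<mu> 0 * t < 1"
    and der: "\<And>N. ((\<lambda>t. \<Prod>i<d N. 1 - m N i * t) has_real_derivative Q' N) (at t)"
    and lim: "Q' \<longlonglongrightarrow> D"
  shows "(\<Sum>i. \<mu> i / (1 - \<mu> i * t)) = - D / F t"
proof -
  \<comment> \<open>The midpoint between \<open>\<mu> 0 * t\<close> and 1. Row entries are largest
    at index 0, so for large \<open>N\<close> all denominators are at least
    \<open>1 - \<rho>\<close>.\<close>
  define \<rho> where "\<rho> = (1 + \<mu> 0 * t) / 2"
  have \<rho>: "\<rho> < 1" "\<mu> 0 * t < \<rho>"
    using t by (auto simp: \<rho>_def mult.commute)
  have "\<forall>\<^sub>F N in sequentially. m N 0 * t < \<rho>"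
    using tendsto_mult_right[OF m_lim[of 0], of t] \<rho>(2) by (rule order_tendstoD)
  then have ev: "\<forall>\<^sub>F N in sequentially. \<forall>i. m N i * t \<le> \<rho>"
  proof eventually_elim
    case (elim N)
    then show ?case
      using mult_right_mono[OF antimonoD[OF antimono_m le0] t(1)] by (meson less_imp_le order_trans)
  qed
  have \<mu>\<rho>: "\<mu> i * t \<le> \<rho>" for i
    using mult_right_mono[OF \<mu>_antimono[of 0 i] t(1)] \<rho>(2) by simp
  have F0: "F t \<noteq> 0"
    using F_nonzero[OF t(1)] \<mu>\<rho> \<rho>(1) by (metis not_less)
  have "(\<lambda>N. \<Sum>i. m N i / (1 - m N i * t)) \<longlonglongrightarrow> (\<Sum>i. \<mu> i / (1 - \<mu> i * t))"
  proof -
    have "\<forall>\<^sub>F x in at_top \<times>\<^sub>F sequentially. \<forall>i. m (snd x) i * t \<le> \<rho>"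
      using eventually_prodI[OF eventually_True[of at_top] ev] by simp
    then have "\<forall>\<^sub>F (i, N) in at_top \<times>\<^sub>F sequentially. norm (m N i / (1 - m N i * t)) \<le> b i / (1 - \<rho>)"
      unfolding case_prod_unfold
    proof eventually_elim
      case (elim x)
      then have "m (snd x) (fst x) * t \<le> \<rho>"
        by blast
      then show ?case
        using m_nonneg[of "snd x" "fst x"] m_le[of "snd x" "fst x"] \<rho>(1) b_nonneg
        by (auto intro!: frac_le simp: abs_divide)
    qed
    moreover have "1 - \<mu> i * t \<noteq> 0" for i
      using \<mu>\<rho>[of i] \<rho>(1) by simp
    then have "(\<lambda>N. m N i / (1 - m N i * t)) \<longlonglongrightarrow> \<mu> i / (1 - \<mu> i * t)" for i
      by (intro tendsto_intros m_lim)
    ultimately show ?thesis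
      using sequentially_bot tannerys_theorem[of "\<lambda>i N. m N i / (1 - m N i * t)" "\<lambda>i. \<mu> i / (1 - \<mu> i * t)"
          sequentially "\<lambda>i. b i / (1 - \<rho>)"] summable_divide[OF summable_b, of "1 - \<rho>"]
      by blast
  qed
  moreover have "(\<lambda>N. \<Sum>i. m N i / (1 - m N i * t)) \<longlonglongrightarrow> - D / F t"
  proof (rule Lim_transform_eventually)
    show "(\<lambda>N. - Q' N / (\<Prod>i<d N. 1 - m N i * t)) \<longlonglongrightarrow> - D / F t"
      by (intro tendsto_intros lim F_lim F0)
    show "\<forall>\<^sub>F N in sequentially. - Q' N / (\<Prod>i<d N. 1 - m N i * t) = (\<Sum>i. m N i / (1 - m N i * t))"
      using ev
    proof eventually_elim
      case (elim N)
      have nz: "m N i * t \<noteq> 1" for i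
        using elim \<rho>(1) by (metis not_less)
      have "Q' N = - (\<Prod>i<d N. 1 - m N i * t) * (\<Sum>i<d N. m N i / (1 - m N i * t))"
        by (rule DERIV_unique[OF der has_real_derivative_prod_linear]) (use nz in auto)
      moreover have "(\<Sum>i. m N i / (1 - m N i * t)) = (\<Sum>i<d N. m N i / (1 - m N i * t))"
        by (rule suminf_finite) (use m_zero in auto)
      moreover have "(\<Prod>i<d N. 1 - m N i * t) \<noteq> 0"
        using nz by auto
      ultimately show ?case
        by simp
    qed
  qed
  ultimately show ?thesis
    by (rule LIMSEQ_unique)
qed

subsection \<open>Polynomial approximation of the power series\<close>

text \<open>With \<open>a = \<nu> + 1\<close> and \<open>b = \<nu> + 2\<close> this is the modulus
  of the coefficient of \<open>x ^ (4 * k)\<close> in \<open>norm_W \<nu>\<close>; the sign is added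
  in \<open>limit_fun\<close>.\<close>

definition limit_coeff :: "real \<Rightarrow> real \<Rightarrow> nat \<Rightarrow> real" where
  "limit_coeff a b k = 1 / (16 ^ k * fact k * pochhammer a k * pochhammer b (2 * k))"

text \<open>Up to the sign, the coefficients of \<open>(1 - s * t) ^ N\<close> with
  \<open>s = 1 / (16 * N ^ 4)\<close> after Euler steps with parameters \<open>a + j\<close> and
  \<open>(b + j) / 2\<close> for \<open>j < N\<close>. The scale \<open>s\<close> compensates the
  growth \<open>N ^ k\<close> of the binomial coefficient and \<open>N ^ k\<close>,
  \<open>N ^ (2 * k)\<close> of the two products.\<close>

definition approx_coeff :: "real \<Rightarrow> real \<Rightarrow> nat \<Rightarrow> nat \<Rightarrow> real" where
  "approx_coeff a b N k = real (N choose k) * (1 / (16 * real N ^ 4)) ^ k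
     * ((\<Prod>j<N. 1 + real k / (a + real j)) * (\<Prod>j<N. 1 + real k / ((b + real j) / 2)))"

text \<open>The factors are \<open>(a + k + j) / (a + j)\<close>. Splitting the rising factorial of
  length \<open>N + k\<close> after \<open>k\<close> or after \<open>N\<close> factors exchanges
  \<open>N\<close> and \<open>k\<close>, which makes the limit in \<open>N\<close>
  accessible.\<close>

lemma prod_shift_pochhammer:
  fixes a :: real
  assumes "a > 0"
  shows "(\<Prod>j<N. 1 + real k / (a + real j)) = pochhammer (a + real N) k / pochhammer a k"
proof -
  have nz: "a + real j \<noteq> 0" for j
    using assms by (metis add_pos_nonneg less_irrefl of_nat_0_le_iff)
  have "(\<Prod>j<N. 1 + real k / (a + real j)) = (\<Prod>j<N. (a + real k + real j) / (a + real j))"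
    using nz by (intro prod.cong) (auto simp: field_simps)
  also have "\<dots> = pochhammer (a + real k) N / pochhammer a N"
    by (simp add: pochhammer_prod prod_dividef atLeast0LessThan)
  also have "\<dots> = pochhammer (a + real N) k / pochhammer a k"
  proof -
    have "pochhammer a k * pochhammer (a + real k) N = pochhammer a N * pochhammer (a + real N) k"
      using pochhammer_product'[of a k N] pochhammer_product'[of a N k] by (simp add: add.commute)
    then show ?thesis
      using pochhammer_pos[OF assms, of k] pochhammer_pos[OF assms, of N] by (simp add: field_simps)
  qed
  finally show ?thesis .
qed

lemma approx_coeff_eq:
  assumes "a > 0" "b > 0" "N > 0"
  shows "approx_coeff a b N k = limit_coeff a b k * ((real (N choose k) * fact k / real N ^ k)
    * (pochhammer (a + real N) k / real N ^ k) * (pochhammer (b + real N) (2 * k) / real N ^ (2 * k)))"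
proof -
  \<comment> \<open>Halving the parameter doubles \<open>k\<close>; this produces the index
    \<open>2 * k\<close> in \<open>limit_coeff\<close>.\<close>
  have "(\<Prod>j<N. 1 + real k / ((b + real j) / 2)) = (\<Prod>j<N. 1 + real (2 * k) / (b + real j))"
    by (intro prod.cong) (auto simp: mult.commute)
  then have b: "(\<Prod>j<N. 1 + real k / ((b + real j) / 2)) = pochhammer (b + real N) (2 * k) / pochhammer b (2 * k)"
    using prod_shift_pochhammer[OF assms(2), of "2 * k" N] by simp
  have "real N ^ (4 * k) = real N ^ k * real N ^ k * real N ^ (2 * k)"
    by (simp flip: power_add)
  then show ?thesis
    unfolding approx_coeff_def limit_coeff_def b prod_shift_pochhammer[OF assms(1)]
    by (simp add: power_mult_distrib power_one_over flip: power_mult)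
qed

lemma approx_coeff_eq_0: "N < k \<Longrightarrow> approx_coeff a b N k = 0"
  by (simp add: approx_coeff_def)

lemma approx_coeff_nonneg:
  assumes "a > 0" "b > 0"
  shows "0 \<le> approx_coeff a b N k"
  using assms by (auto simp: approx_coeff_def intro!: mult_nonneg_nonneg prod_nonneg)

lemma limit_coeff_pos:
  assumes "a > 0" "b > 0"
  shows "0 < limit_coeff a b k"
  using assms by (simp add: limit_coeff_def pochhammer_pos)

lemma approx_coeff_lim:
  assumes "a > 0" "b > 0"
  shows "(\<lambda>N. approx_coeff a b N k) \<longlonglongrightarrow> limit_coeff a b k"
proof -
  have one: "(\<lambda>N. (real N + x) / real N) \<longlonglongrightarrow> 1" for x :: real
    by real_asymp
  have P: "(\<lambda>N. pochhammer (x + real N) l / real N ^ l) \<longlonglongrightarrow> 1" for x :: real and l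
  proof -
    have "(\<lambda>N. \<Prod>j<l. (real N + (x + real j)) / real N) \<longlonglongrightarrow> (\<Prod>j<l. 1)"
      by (intro tendsto_prod one)
    then show ?thesis
      by (simp add: pochhammer_prod prod_dividef atLeast0LessThan add_ac)
  qed
  have B: "(\<lambda>N. real (N choose k) * fact k / real N ^ k) \<longlonglongrightarrow> 1"
  proof -
    have "(\<lambda>N. \<Prod>j<k. (real N + (- real j)) / real N) \<longlonglongrightarrow> (\<Prod>j<k. 1)"
      by (intro tendsto_prod one)
    then show ?thesis
      by (simp add: binomial_gbinomial gbinomial_prod_rev prod_dividef atLeast0LessThan)
  qed
  have "(\<lambda>N. limit_coeff a b k * ((real (N choose k) * fact k / real N ^ k)
    * (pochhammer (a + real N) k / real N ^ k) * (pochhammer (b + real N) (2 * k) / real N ^ (2 * k))))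
    \<longlonglongrightarrow> limit_coeff a b k * (1 * 1 * 1)"
    by (intro tendsto_mult B P tendsto_const)
  then have "(\<lambda>N. limit_coeff a b k * ((real (N choose k) * fact k / real N ^ k)
    * (pochhammer (a + real N) k / real N ^ k) * (pochhammer (b + real N) (2 * k) / real N ^ (2 * k))))
    \<longlonglongrightarrow> limit_coeff a b k"
    by simp
  moreover have "\<forall>\<^sub>F N in sequentially. limit_coeff a b k * ((real (N choose k) * fact k / real N ^ k)
        * (pochhammer (a + real N) k / real N ^ k) * (pochhammer (b + real N) (2 * k) / real N ^ (2 * k)))
        = approx_coeff a b N k"
    using eventually_gt_at_top[of 0] by eventually_elim (simp add: approx_coeff_eq[OF assms])
  ultimately show ?thesis
    by (rule Lim_transform_eventually)
qed

text \<open>Pairing \<open>i + 1\<close> with \<open>n - i\<close> arranges the square of the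
  factorial into \<open>n\<close> factors that are each at least \<open>n\<close>.\<close>

lemma power_self_le_fact_square: "real n ^ n \<le> (fact n)\<^sup>2"
proof -
  have "(\<Prod>i<n. real n) \<le> (\<Prod>i<n. real (Suc i) * real (n - i))"
  proof (rule prod_mono, safe)
    fix i assume "i < n"
    then obtain l where "n = Suc (i + l)"
      by (auto dest: less_imp_Suc_add)
    then show "real n \<le> real (Suc i) * real (n - i)"
      by (simp add: algebra_simps Suc_diff_le)
  qed simp
  also have "\<dots> = (\<Prod>i<n. real (Suc i)) * (\<Prod>i<n. real (n - i))"
    by (rule prod.distrib)
  also have "(\<Prod>i<n. real (Suc i)) = fact n"
    by (simp add: fact_prod_Suc atLeast0LessThan)
  also have "(\<Prod>i<n. real (n - i)) = fact n"
    by (simp add: fact_prod_rev atLeast0LessThan)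
  finally show ?thesis
    by (simp add: power2_eq_square)
qed

lemma pochhammer_le_power:
  fixes x :: real
  assumes "0 \<le> x" "x + real k \<le> y"
  shows "pochhammer x k \<le> y ^ k"
proof -
  have "(\<Prod>i<k. x + real i) \<le> (\<Prod>i<k. y)"
    using assms by (intro prod_mono) auto
  then show ?thesis
    by (simp add: pochhammer_prod atLeast0LessThan)
qed

text \<open>Collects the geometric factors of \<open>approx_coeff_le\<close>: \<open>a + 2\<close>
  and \<open>(b + 3)\<^sup>2\<close> from the numerators, 16 and \<open>min a 1\<close> from the
  denominator.\<close>

definition coeff_rate :: "real \<Rightarrow> real \<Rightarrow> real" where
  "coeff_rate a b = (a + 2) * (b + 3)\<^sup>2 / (16 * min a 1)"

lemma coeff_rate_pos: "a > 0 \<Longrightarrow> b > 0 \<Longrightarrow> 0 < coeff_rate a b"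
  by (simp add: coeff_rate_def)

text \<open>The bound is uniform in \<open>N\<close>. One factorial stands in
  \<open>limit_coeff\<close>, one comes from \<open>pochhammer a k\<close>, and two come from
  \<open>pochhammer b (2 * k) \<ge> fact (2 * k)\<close>, which uses \<open>b \<ge> 1\<close>; the
  factors depending on \<open>N\<close> grow at most geometrically in \<open>k\<close>.\<close>

lemma approx_coeff_le:
  assumes a: "a > 0" and b: "b \<ge> 1" and N: "N > 0"
  shows "approx_coeff a b N k \<le> coeff_rate a b ^ k / fact k ^ 4"
proof (cases "k \<le> N")
  case False
  then show ?thesis
    using coeff_rate_pos[of a b] a b by (simp add: approx_coeff_eq_0)
next
  case True
  \<comment> \<open>Chosen so that \<open>a + i \<ge> \<delta> * (i + 1)\<close> for every
    \<open>i\<close>, also when \<open>a < 1\<close>.\<close>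
  define \<delta> where "\<delta> = min a 1"
  have \<delta>: "0 < \<delta>" "\<delta> \<le> a" "\<delta> \<le> 1"
    using a by (auto simp: \<delta>_def)
  have N1: "1 \<le> real N" "real k \<le> real N"
    using N True by auto
  have B: "real (N choose k) * fact k / real N ^ k \<le> 1"
  proof -
    have "real ((N choose k) * fact k) \<le> real (N ^ k)"
      using binomial_fact_pow[of N k] by (rule of_nat_mono)
    then show ?thesis
      using N by simp
  qed
  have A: "pochhammer (a + real N) k / real N ^ k \<le> (a + 2) ^ k"
  proof -
    have "a * 1 \<le> a * real N"
      using a N1 by (intro mult_left_mono) auto
    then have "a + real N + real k \<le> (a + 2) * real N"
      using N1 by (simp add: algebra_simps)
    then show ?thesis
      using pochhammer_le_power[of "a + real N" k "(a + 2) * real N"] a N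
      by (simp add: power_mult_distrib divide_le_eq)
  qed
  have C: "pochhammer (b + real N) (2 * k) / real N ^ (2 * k) \<le> (b + 3) ^ (2 * k)"
  proof -
    have "b * 1 \<le> b * real N"
      using b N1 by (intro mult_left_mono) auto
    then have "b + real N + real (2 * k) \<le> (b + 3) * real N"
      using N1 by (simp add: algebra_simps)
    then show ?thesis
      using pochhammer_le_power[of "b + real N" "2 * k" "(b + 3) * real N"] b N
      by (simp add: power_mult_distrib divide_le_eq)
  qed
  have pa: "\<delta> ^ k * fact k \<le> pochhammer a k"
  proof -
    have "(\<Prod>i<k. \<delta> * real (Suc i)) \<le> (\<Prod>i<k. a + real i)"
    proof (rule prod_mono, safe)
      fix i
      have "\<delta> * real i \<le> 1 * real i"
        using \<delta> by (intro mult_right_mono) auto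
      then show "\<delta> * real (Suc i) \<le> a + real i"
        using \<delta> by (simp add: algebra_simps)
    qed (use \<delta> in simp)
    then show ?thesis
      by (simp add: pochhammer_prod prod.distrib fact_prod_Suc atLeast0LessThan)
  qed
  have pb: "fact k ^ 2 \<le> pochhammer b (2 * k)"
  proof -
    have "fact k ^ 2 \<le> (fact (2 * k) :: real)"
    proof -
      have "fact k * fact k \<le> (fact (k + k) :: nat)"
        using dvd_imp_le[OF fact_fact_dvd_fact[of k k]] by simp
      then have "real (fact k * fact k) \<le> real (fact (k + k))"
        by (rule of_nat_mono)
      then show ?thesis
        by (simp add: power2_eq_square mult_2)
    qed
    also have "(fact (2 * k) :: real) = (\<Prod>i<2 * k. 1 + real i)"
      by (simp add: fact_prod_Suc atLeast0LessThan)
    also have "\<dots> \<le> (\<Prod>i<2 * k. b + real i)"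
      using b by (intro prod_mono) auto
    finally show ?thesis
      by (simp add: pochhammer_prod atLeast0LessThan)
  qed
  have L: "limit_coeff a b k \<le> 1 / (16 ^ k * fact k * (\<delta> ^ k * fact k) * fact k ^ 2)"
    unfolding limit_coeff_def using pa pb \<delta>
    by (intro divide_left_mono mult_mono)
      (auto intro!: mult_pos_pos mult_nonneg_nonneg pochhammer_pos pochhammer_nonneg a
        less_le_trans[OF zero_less_one b])
  have "approx_coeff a b N k = limit_coeff a b k * ((real (N choose k) * fact k / real N ^ k)
    * (pochhammer (a + real N) k / real N ^ k) * (pochhammer (b + real N) (2 * k) / real N ^ (2 * k)))"
    using a b N by (simp add: approx_coeff_eq)
  also have "\<dots> \<le> 1 / (16 ^ k * fact k * (\<delta> ^ k * fact k) * fact k ^ 2) * (1 * (a + 2) ^ k * (b + 3) ^ (2 * k))"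
    using a b N \<delta> by (intro mult_mono L A B C) (auto intro!: mult_nonneg_nonneg divide_nonneg_nonneg pochhammer_nonneg)
  also have "\<dots> = coeff_rate a b ^ k / fact k ^ 4"
    by (simp add: coeff_rate_def \<delta>_def[symmetric] power_mult_distrib power_divide
        eval_nat_numeral mult_ac power_add mult_2)
  finally show ?thesis .
qed

text \<open>The Euler steps realize the approximating coefficients by a polynomial with positive
  roots. Factorial decay of the coefficients bounds the product of the \<open>k\<close> largest
  reciprocal roots, hence the \<open>k\<close>-th largest itself, uniformly in
  \<open>N\<close>.\<close>

lemma approx_product:
  assumes a: "a > 0" and b: "b \<ge> 1" and N: "N > 0"
  obtains m :: "nat \<Rightarrow> real" where "antimono m" "\<And>i. 0 \<le> m i" "\<And>i. N \<le> i \<Longrightarrow> m i = 0"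
    "\<And>i. m i \<le> coeff_rate a b / (real (Suc i))\<^sup>2"
    "\<And>t. (\<Prod>i<N. 1 - m i * t) = (\<Sum>k\<le>N. (-1) ^ k * approx_coeff a b N k * t ^ k)"
proof -
  define s where "s = 1 / (16 * real N ^ 4)"
  have s: "s > 0"
    using N by (simp add: s_def)
  obtain p where p: "pos_rooted p" "\<And>k. coeff p k
      = of_real (\<Prod>j<N. 1 + real k / (a + real j)) * coeff ([:1, - of_real s:] ^ N) k"
    by (rule pos_rooted_multiplier[OF pos_rooted_power_linear[OF s], of N "\<lambda>j. a + real j"])
      (use a in auto)
  obtain q where q: "pos_rooted q" "\<And>k. coeff q k
      = of_real (\<Prod>j<N. 1 + real k / ((b + real j) / 2)) * coeff p k"
    by (rule pos_rooted_multiplier[OF p(1), of N "\<lambda>j. (b + real j) / 2"]) (use b in auto)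
  have cq: "coeff q k = of_real ((-1) ^ k * approx_coeff a b N k)" for k
    unfolding q(2) p(2) coeff_power_linear approx_coeff_def s_def
    by (simp add: power_minus[of "_ / _"] mult_ac)
  have deg: "degree q \<le> N"
    by (rule degree_le) (simp add: cq approx_coeff_eq_0)
  have "poly q 0 = 1"
    by (simp add: poly_0_coeff_0 cq approx_coeff_def)
  then obtain m where m: "antimono m" "\<And>i. 0 \<le> m i" "\<And>i. N \<le> i \<Longrightarrow> m i = 0"
    "q = (\<Prod>i<N. [:1, - of_real (m i):])"
    using pos_rooted_factorization[OF q(1) _ deg] by metis
  have prod_eq: "(\<Prod>i<N. 1 - m i * t) = (\<Sum>k\<le>N. (-1) ^ k * approx_coeff a b N k * t ^ k)" for t
  proof -
    have "poly q (of_real t) = of_real (\<Prod>i<N. 1 - m i * t)"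
      unfolding m(4) by (simp add: poly_prod mult.commute)
    moreover have "poly q (of_real t) = (\<Sum>k\<le>N. coeff q k * of_real t ^ k)"
      unfolding poly_altdef using deg by (intro sum.mono_neutral_left) (auto simp: coeff_eq_0)
    then have "poly q (of_real t) = of_real (\<Sum>k\<le>N. (-1) ^ k * approx_coeff a b N k * t ^ k)"
      by (simp add: cq)
    ultimately show ?thesis
      by (metis of_real_eq_iff)
  qed
  \<comment> \<open>Replacing \<open>t\<close> by \<open>- t\<close> removes the signs, so that
    \<open>coeff_prod_linear_ge\<close> applies.\<close>
  have "(\<Prod>i<N. [:1, m i:]) = (\<Sum>k\<le>N. monom (approx_coeff a b N k) k)"
  proof (rule poly_eq_poly_eq_iff[THEN iffD1], rule ext)
    fix t
    have "(\<Sum>k\<le>N. (- 1) ^ k * approx_coeff a b N k * (- t) ^ k) = (\<Sum>k\<le>N. approx_coeff a b N k * t ^ k)"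
      by (intro sum.cong) (auto simp: power_minus[of t] simp flip: power_add mult_2)
    then show "poly (\<Prod>i<N. [:1, m i:]) t = poly (\<Sum>k\<le>N. monom (approx_coeff a b N k) k) t"
      using prod_eq[of "- t"] by (simp add: poly_prod poly_sum poly_monom mult.commute)
  qed
  then have cm: "coeff (\<Prod>i<N. [:1, m i:]) k = approx_coeff a b N k" for k
    by (simp add: coeff_sum approx_coeff_eq_0)
  \<comment> \<open>The \<open>k\<close>-th coefficient is the \<open>k\<close>-th elementary symmetric function, hence at least \<open>m\<^sub>0 \<cdots> m\<^sub>k\<^sub>-\<^sub>1\<close>.\<close>
  have "m i \<le> coeff_rate a b / (real (Suc i))\<^sup>2" for i
  proof (cases "Suc i \<le> N")
    case False
    then show ?thesis
      using m(3)[of i] coeff_rate_pos[of a b] a b by (simp add: not_less_eq_eq)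
  next
    case True
    define k where "k = Suc i"
    have "m i ^ k = (\<Prod>j<k. m i)"
      by simp
    also have "\<dots> \<le> (\<Prod>j<k. m j)"
      using m(2) antimonoD[OF m(1)] by (intro prod_mono) (auto simp: k_def)
    also have "\<dots> \<le> approx_coeff a b N k"
      using coeff_prod_linear_ge(2)[of m k N] m(2) True by (simp add: cm k_def)
    also have "\<dots> \<le> coeff_rate a b ^ k / fact k ^ 4"
      by (rule approx_coeff_le[OF a b N])
    \<comment> \<open>By \<open>power_self_le_fact_square\<close> the bound becomes a perfect
      \<open>k\<close>-th power, and \<open>k\<close>-th roots can be taken.\<close>
    also have "\<dots> \<le> coeff_rate a b ^ k / ((real k)\<^sup>2) ^ k"
    proof (rule divide_left_mono)
      have "(real k ^ k)\<^sup>2 \<le> ((fact k)\<^sup>2)\<^sup>2"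
        by (rule power_mono[OF power_self_le_fact_square]) simp
      then show "((real k)\<^sup>2) ^ k \<le> fact k ^ 4"
        by (simp add: mult.commute flip: power_mult)
    qed (use coeff_rate_pos[of a b] a b in \<open>auto simp: k_def\<close>)
    also have "\<dots> = (coeff_rate a b / (real k)\<^sup>2) ^ Suc i"
      by (simp add: power_divide k_def)
    finally show ?thesis
      unfolding k_def by (rule power_le_imp_le_base) (use coeff_rate_pos[of a b] a b in auto)
  qed
  then show ?thesis
    by (intro that[of m] m(1-3) prod_eq)
qed

lemma power_series_tendsto:
  fixes c :: "nat \<Rightarrow> nat \<Rightarrow> real"
  assumes "\<And>k. (\<lambda>N. c N k) \<longlonglongrightarrow> l k" "\<And>N k. \<bar>c N k\<bar> \<le> C k" "summable (\<lambda>k. C k * \<bar>t\<bar> ^ k)"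
  shows "(\<lambda>N. \<Sum>k. c N k * t ^ k) \<longlonglongrightarrow> (\<Sum>k. l k * t ^ k)"
proof -
  have "\<forall>\<^sub>F (k, N) in at_top \<times>\<^sub>F sequentially. norm (c N k * t ^ k) \<le> C k * \<bar>t\<bar> ^ k"
    using assms(2) by (intro always_eventually) (simp add: case_prod_unfold abs_mult power_abs mult_right_mono)
  moreover have "(\<lambda>N. c N k * t ^ k) \<longlonglongrightarrow> l k * t ^ k" for k
    by (intro tendsto_mult assms(1) tendsto_const)
  ultimately show ?thesis
    using tannerys_theorem[of "\<lambda>k N. c N k * t ^ k" "\<lambda>k. l k * t ^ k" sequentially "\<lambda>k. C k * \<bar>t\<bar> ^ k"]
      assms(3) sequentially_bot by blast
qed

lemma summable_coeff_rate:
  assumes "a > 0" "b > 0"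
  shows "summable (\<lambda>k. coeff_rate a b ^ k / fact k ^ 4 * t ^ k)"
proof (rule summable_comparison_test')
  show "summable (\<lambda>k. (coeff_rate a b * \<bar>t\<bar>) ^ k / fact k)"
    using summable_exp[of "coeff_rate a b * \<bar>t\<bar>"] by (simp add: divide_inverse mult.commute)
  show "norm (coeff_rate a b ^ k / fact k ^ 4 * t ^ k) \<le> (coeff_rate a b * \<bar>t\<bar>) ^ k / fact k" for k
  proof -
    have "fact k ^ 1 \<le> (fact k ^ 4 :: real)"
      by (rule power_increasing) auto
    then have "(coeff_rate a b * \<bar>t\<bar>) ^ k / fact k ^ 4 \<le> (coeff_rate a b * \<bar>t\<bar>) ^ k / fact k"
      using coeff_rate_pos[OF assms] by (intro divide_left_mono) auto
    then show ?thesis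
      using coeff_rate_pos[OF assms] by (simp add: abs_mult power_abs power_mult_distrib)
  qed
qed

section \<open>The limit function, its zeros and its partial fractions\<close>

definition limit_fun :: "real \<Rightarrow> real \<Rightarrow> real \<Rightarrow> real" where
  "limit_fun a b t = (\<Sum>k. (-1) ^ k * limit_coeff a b k * t ^ k)"

lemma limit_coeff_le:
  assumes "a > 0" "b \<ge> 1"
  shows "limit_coeff a b k \<le> coeff_rate a b ^ k / fact k ^ 4"
proof (rule LIMSEQ_le_const2)
  show "(\<lambda>N. approx_coeff a b N k) \<longlonglongrightarrow> limit_coeff a b k"
    using assms by (intro approx_coeff_lim) auto
  show "\<exists>M. \<forall>N\<ge>M. approx_coeff a b N k \<le> coeff_rate a b ^ k / fact k ^ 4"
    using approx_coeff_le[OF assms] by (intro exI[of _ 1]) auto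
qed

lemma summable_limit_coeff:
  assumes "a > 0" "b \<ge> 1"
  shows "summable (\<lambda>k. (-1) ^ k * limit_coeff a b k * t ^ k)"
proof (rule summable_comparison_test')
  show "summable (\<lambda>k. coeff_rate a b ^ k / fact k ^ 4 * \<bar>t\<bar> ^ k)"
    using assms by (intro summable_coeff_rate) auto
  show "norm ((-1) ^ k * limit_coeff a b k * t ^ k) \<le> coeff_rate a b ^ k / fact k ^ 4 * \<bar>t\<bar> ^ k" for k
    using mult_right_mono[OF limit_coeff_le[OF assms, of k], of "\<bar>t\<bar> ^ k"] limit_coeff_pos[of a b k] assms
    by (simp add: abs_mult power_abs)
qed

lemma has_real_derivative_limit_fun:
  assumes "a > 0" "b \<ge> 1"
  shows "(limit_fun a b has_real_derivative
    (\<Sum>k. diffs (\<lambda>k. (-1) ^ k * limit_coeff a b k) k * t ^ k)) (at t)"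
  unfolding limit_fun_def[abs_def]
  by (rule termdiffs_strong_converges_everywhere) (rule summable_limit_coeff[OF assms])

lemma limit_fun_0: "limit_fun a b 0 = 1"
  using powser_zero[of "\<lambda>k. (-1) ^ k * limit_coeff a b k"] by (simp add: limit_fun_def limit_coeff_def)

text \<open>Along a subsequence the reciprocal roots of the approximants converge, and their
  products converge to the limit function, so \<open>product_limit\<close> applies. A growth
  argument then excludes that some \<open>\<mu> i\<close> is 0.\<close>

lemma limit_fun_zeros:
  assumes a: "a > 0" and b: "b \<ge> 1"
  obtains \<mu> :: "nat \<Rightarrow> real" where "antimono \<mu>" "\<And>i. 0 < \<mu> i" "summable \<mu>"
    "\<And>t. 0 \<le> t \<Longrightarrow> limit_fun a b t = 0 \<longleftrightarrow> (\<exists>i. \<mu> i * t = 1)"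
    "\<And>i j. i \<noteq> j \<Longrightarrow> \<mu> i = \<mu> j \<Longrightarrow> deriv (limit_fun a b) (1 / \<mu> i) = 0"
    "\<And>t. 0 \<le> t \<Longrightarrow> \<mu> 0 * t < 1 \<Longrightarrow>
      (\<Sum>i. \<mu> i / (1 - \<mu> i * t)) = - deriv (limit_fun a b) t / limit_fun a b t"
proof -
  define K where "K = coeff_rate a b"
  define B where "B = (\<lambda>i. K / (real (Suc i))\<^sup>2)"
  have K: "K > 0"
    using a b by (simp add: K_def coeff_rate_pos)
  \<comment> \<open>Row \<open>N\<close> uses \<open>Suc N\<close> factors, because
    \<open>approx_product\<close> asks for a positive number of them.\<close>
  have "\<exists>m. antimono m \<and> (\<forall>i. 0 \<le> m i) \<and> (\<forall>i\<ge>Suc N. m i = 0) \<and> (\<forall>i. m i \<le> B i) \<and>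
      (\<forall>t. (\<Prod>i<Suc N. 1 - m i * t) = (\<Sum>k\<le>Suc N. (-1) ^ k * approx_coeff a b (Suc N) k * t ^ k))" for N
    by (rule approx_product[OF a b zero_less_Suc[of N]]) (unfold B_def K_def, blast)
  then obtain m where m: "\<And>N. antimono (m N)" "\<And>N i. 0 \<le> m N i" "\<And>N i. Suc N \<le> i \<Longrightarrow> m N i = 0"
      "\<And>N i. m N i \<le> B i"
      "\<And>N t. (\<Prod>i<Suc N. 1 - m N i * t) = (\<Sum>k\<le>Suc N. (-1) ^ k * approx_coeff a b (Suc N) k * t ^ k)"
    by metis
  have "B i \<le> K" for i
    using K by (simp add: B_def divide_le_eq mult_le_cancel_left1)
  then have "norm (m N i) \<le> K" for N i
    using m(2)[of N i] m(4)[of N i] order_trans by fastforce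
  \<comment> \<open>All entries are bounded by \<open>K\<close>, so a diagonal argument gives one
    subsequence that works for every index \<open>i\<close>.\<close>
  then have "\<exists>r. strict_mono (r :: nat \<Rightarrow> nat) \<and> (\<forall>i. \<exists>l. (\<lambda>N. m (r N) i) \<longlonglongrightarrow> l)"
    by (rule function_convergent_subsequence[OF countableI_type[of UNIV], of m K]) auto
  then obtain r \<mu> where r: "strict_mono (r :: nat \<Rightarrow> nat)" and \<mu>: "\<And>i. (\<lambda>N. m (r N) i) \<longlonglongrightarrow> \<mu> i"
    by metis
  define c where "c = (\<lambda>N k. (-1) ^ k * approx_coeff a b (Suc (r N)) k)"
  define C where "C = (\<lambda>k. K ^ k / fact k ^ 4)"
  have prod_eq: "(\<Prod>i<Suc (r N). 1 - m (r N) i * t) = (\<Sum>k. c N k * t ^ k)" for N t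
    unfolding m(5) c_def by (rule suminf_finite[symmetric]) (auto simp: approx_coeff_eq_0)
  have c_lim: "(\<lambda>N. c N k) \<longlonglongrightarrow> (-1) ^ k * limit_coeff a b k" for k
  proof -
    have "(\<lambda>N. approx_coeff a b N k) \<longlonglongrightarrow> limit_coeff a b k"
      using a b by (intro approx_coeff_lim) auto
    from LIMSEQ_subseq_LIMSEQ[OF LIMSEQ_Suc[OF this] r]
    show ?thesis
      unfolding c_def by (intro tendsto_mult tendsto_const) (simp add: o_def)
  qed
  have c_le: "\<bar>c N k\<bar> \<le> C k" for N k
    using approx_coeff_le[OF a b, of "Suc (r N)" k] approx_coeff_nonneg[of a b "Suc (r N)" k] a b
    by (simp add: c_def C_def K_def abs_mult)
  have C_sum: "summable (\<lambda>k. C k * t ^ k)" for t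
    unfolding C_def K_def using a b by (intro summable_coeff_rate) auto
  have F_lim: "(\<lambda>N. \<Prod>i<Suc (r N). 1 - m (r N) i * t) \<longlonglongrightarrow> limit_fun a b t" for t
    unfolding prod_eq limit_fun_def by (rule power_series_tendsto[OF c_lim c_le C_sum])
  interpret product_limit "\<lambda>N. m (r N)" "\<lambda>N. Suc (r N)" B \<mu> "limit_fun a b"
  proof
    show "summable B"
      using summable_mult[OF inverse_squares_sums[THEN sums_summable], of K]
      by (simp add: B_def add.commute)
  qed (use m \<mu> F_lim in auto)
  define D where "D = (\<lambda>t. \<Sum>k. diffs (\<lambda>k. (-1) ^ k * limit_coeff a b k) k * t ^ k)"
  have D: "(limit_fun a b has_real_derivative D t) (at t)" "deriv (limit_fun a b) t = D t" for t
    using has_real_derivative_limit_fun[OF a b, of t] by (auto simp: D_def intro: DERIV_imp_deriv)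
  have "(\<lambda>N. \<Sum>k. diffs (c N) k * t ^ k) \<longlonglongrightarrow> D t" for t
    unfolding D_def
  proof (rule power_series_tendsto)
    show "(\<lambda>N. diffs (c N) k) \<longlonglongrightarrow> diffs (\<lambda>k. (-1) ^ k * limit_coeff a b k) k" for k
      unfolding diffs_def by (intro tendsto_intros c_lim)
    show "\<bar>diffs (c N) k\<bar> \<le> diffs C k" for N k
      using c_le[of N "Suc k"] by (simp add: diffs_def abs_mult del: of_nat_Suc)
    show "summable (\<lambda>k. diffs C k * \<bar>t\<bar> ^ k)"
      by (rule termdiff_converges_all) (rule C_sum)
  qed
  moreover have "((\<lambda>t. \<Prod>i<Suc (r N). 1 - m (r N) i * t) has_real_derivative
      (\<Sum>k. diffs (c N) k * t ^ k)) (at t)" for N t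
    unfolding prod_eq
  proof (rule termdiffs_strong_converges_everywhere)
    show "summable (\<lambda>k. c N k * y ^ k)" for y
      by (rule summable_comparison_test'[OF C_sum[of "\<bar>y\<bar>"]])
        (use c_le in \<open>auto simp: abs_mult power_abs intro!: mult_right_mono\<close>)
  qed
  ultimately have logd: "(\<Sum>i. \<mu> i / (1 - \<mu> i * t)) = - deriv (limit_fun a b) t / limit_fun a b t"
    if "0 \<le> t" "\<mu> 0 * t < 1" for t
    unfolding D(2) using that by (intro log_derivative) auto
  \<comment> \<open>With only \<open>i\<close> positive \<open>\<mu>\<close>, the function would be \<open>O(s\<^sup>i)\<close> at \<open>- s\<close>, but its series contains \<open>s\<^bsup>i+1\<^esup>\<close>.\<close>
  have pos: "0 < \<mu> i" for i
  proof (rule ccontr)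
    assume "\<not> 0 < \<mu> i"
    then have z: "\<mu> j = 0" if "i \<le> j" for j
      using \<mu>_antimono[OF that] \<mu>_nonneg[of j] by simp
    have "(\<Sum>i. \<mu> i) = (\<Sum>j<i. \<mu> j)"
      by (rule suminf_finite) (use z in auto)
    then have F_le: "\<bar>limit_fun a b t\<bar> \<le> (\<Prod>j<i. \<bar>1 - \<mu> j * t\<bar>)" for t
      using F_bound[of "{..<i}" t] by simp
    define l where "l = limit_coeff a b (Suc i)"
    have l: "l > 0"
      using limit_coeff_pos[of a b "Suc i"] a b by (simp add: l_def)
    have "l * s \<le> (1 + \<mu> 0) ^ i" if s: "s \<ge> 1" for s
    proof -
      have pm: "(-1) ^ k * limit_coeff a b k * (- s) ^ k = limit_coeff a b k * s ^ k" for k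
        by (auto simp: power_minus[of s] simp flip: power_add mult_2)
      have "(\<Sum>k\<in>{Suc i}. limit_coeff a b k * s ^ k) \<le> (\<Sum>k. limit_coeff a b k * s ^ k)"
        using summable_limit_coeff[OF a b, of "- s"] limit_coeff_pos[of a b] a b s
        by (intro sum_le_suminf) (auto simp: pm less_imp_le)
      also have "\<dots> = limit_fun a b (- s)"
        by (simp add: limit_fun_def pm)
      also have "\<dots> \<le> (\<Prod>j<i. \<bar>1 - \<mu> j * - s\<bar>)"
        using F_le[of "- s"] by simp
      also have "\<dots> \<le> (\<Prod>j<i. (1 + \<mu> 0) * s)"
      proof (intro prod_mono conjI)
        fix j
        have "\<bar>1 - \<mu> j * - s\<bar> = 1 + \<mu> j * s"
          using \<mu>_nonneg[of j] s by simp
        also have "\<dots> \<le> s + \<mu> 0 * s"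
          using \<mu>_antimono[of 0 j] s by (intro add_mono mult_right_mono) auto
        finally show "\<bar>1 - \<mu> j * - s\<bar> \<le> (1 + \<mu> 0) * s"
          by (simp add: algebra_simps)
      qed simp
      also have "\<dots> = (1 + \<mu> 0) ^ i * s ^ i"
        by (simp add: power_mult_distrib)
      finally have "(l * s) * s ^ i \<le> (1 + \<mu> 0) ^ i * s ^ i"
        by (simp add: l_def)
      then show ?thesis
        using s by (simp add: mult_le_cancel_right)
    qed
    \<comment> \<open>Here \<open>l * s\<close> equals \<open>l + (1 + \<mu> 0) ^ i\<close>, which
      exceeds the bound.\<close>
    from this[of "1 + (1 + \<mu> 0) ^ i / l"] show False
      using l \<mu>_nonneg[of 0] by (simp add: distrib_left)
  qed
  show ?thesis
  proof (rule that)
    show "antimono \<mu>"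
      by (rule antimonoI) (rule \<mu>_antimono)
    show "deriv (limit_fun a b) (1 / \<mu> i) = 0" if "i \<noteq> j" "\<mu> i = \<mu> j" for i j
      unfolding D(2) using that pos[of j] by (intro double_zero[OF that _ D(1)]) auto
  qed (use pos summable_\<mu> F_eq_0_iff logd in auto)
qed

subsection \<open>The Bessel cross-product\<close>

definition clifford_coeff :: "real \<Rightarrow> nat \<Rightarrow> real" where
  "clifford_coeff \<nu> k = 1 / (fact k * Gamma (\<nu> + real k + 1))"

lemma clifford_coeff_pos: "\<nu> > -1 \<Longrightarrow> 0 < clifford_coeff \<nu> k"
  using Gamma_step(2)[of \<nu> k] by (simp add: clifford_coeff_def)

lemma clifford_coeff_Suc:
  "real (Suc k) * clifford_coeff \<nu> (Suc k) = clifford_coeff (\<nu> + 1) k"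
proof -
  have "clifford_coeff \<nu> (Suc k) = clifford_coeff (\<nu> + 1) k / real (Suc k)"
    by (simp add: clifford_coeff_def add_ac del: of_nat_Suc)
      (simp add: field_simps)
  then show ?thesis
    by (simp del: of_nat_Suc)
qed

text \<open>The functional equation of \<open>Gamma\<close>. On series it says that
  \<open>t * f' + (\<nu> + 1) * f\<close> is \<open>clifford \<nu>\<close> for
  \<open>f = clifford (\<nu> + 1)\<close>, so it lowers the order.\<close>

lemma clifford_coeff_shift:
  assumes "\<nu> > -1"
  shows "(\<nu> + real k + 1) * clifford_coeff (\<nu> + 1) k = clifford_coeff \<nu> k"
proof -
  have "\<nu> + real k + 1 > 0"
    using assms by simp
  moreover have "Gamma (\<nu> + 1 + real k + 1) = (\<nu> + real k + 1) * Gamma (\<nu> + real k + 1)"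
    using Gamma_step(1)[OF assms, of k] by (simp add: add_ac)
  ultimately show ?thesis
    by (simp add: clifford_coeff_def)
qed

lemma clifford_sums:
  assumes "\<nu> > -1"
  shows "(\<lambda>k. clifford_coeff \<nu> k * t ^ k) sums clifford \<nu> t"
  using summable_sums[OF summable_clifford[OF assms, of t]] by (simp add: clifford_def clifford_coeff_def)

lemma summable_norm_clifford:
  assumes "\<nu> > -1"
  shows "summable (\<lambda>k. norm (clifford_coeff \<nu> k * t ^ k))"
  using sums_summable[OF clifford_sums[OF assms, of "\<bar>t\<bar>"]] clifford_coeff_pos[OF assms]
  by (simp add: abs_mult power_abs less_imp_le)

text \<open>The three-term recurrence of the Bessel functions. The coefficients of
  \<open>t * clifford (\<nu> + 2) t\<close> are \<open>k * clifford_coeff (\<nu> + 1) k\<close>, to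
  which \<open>clifford_coeff_shift\<close> applies.\<close>

lemma clifford_recurrence:
  assumes "\<nu> > -1"
  shows "t * clifford (\<nu> + 2) t + (\<nu> + 1) * clifford (\<nu> + 1) t = clifford \<nu> t"
proof -
  have "(\<lambda>k. t * (clifford_coeff (\<nu> + 2) k * t ^ k)) sums (t * clifford (\<nu> + 2) t)"
    using assms by (intro sums_mult clifford_sums) simp
  moreover have "t * (clifford_coeff (\<nu> + 2) k * t ^ k) = real (Suc k) * clifford_coeff (\<nu> + 1) (Suc k) * t ^ Suc k" for k
    using clifford_coeff_Suc[of k "\<nu> + 1"] by (simp add: add.assoc del: of_nat_Suc)
  ultimately have "(\<lambda>k. real (Suc k) * clifford_coeff (\<nu> + 1) (Suc k) * t ^ Suc k) sums (t * clifford (\<nu> + 2) t)"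
    by (simp del: of_nat_Suc)
  then have "(\<lambda>k. real k * clifford_coeff (\<nu> + 1) k * t ^ k) sums (t * clifford (\<nu> + 2) t)"
    by (subst (asm) sums_Suc_iff) simp
  moreover have "(\<lambda>k. (\<nu> + 1) * (clifford_coeff (\<nu> + 1) k * t ^ k)) sums ((\<nu> + 1) * clifford (\<nu> + 1) t)"
    using assms by (intro sums_mult clifford_sums) simp
  ultimately have "(\<lambda>k. real k * clifford_coeff (\<nu> + 1) k * t ^ k + (\<nu> + 1) * (clifford_coeff (\<nu> + 1) k * t ^ k))
      sums (t * clifford (\<nu> + 2) t + (\<nu> + 1) * clifford (\<nu> + 1) t)"
    by (rule sums_add)
  moreover have "real k * clifford_coeff (\<nu> + 1) k * t ^ k + (\<nu> + 1) * (clifford_coeff (\<nu> + 1) k * t ^ k)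
      = clifford_coeff \<nu> k * t ^ k" for k
    unfolding clifford_coeff_shift[OF assms, of k, symmetric] by (simp add: algebra_simps)
  ultimately show ?thesis
    using clifford_sums[OF assms, of t] sums_unique2 by simp
qed

lemma clifford_pos:
  assumes "\<nu> > -1" "0 \<le> t"
  shows "0 < clifford \<nu> t"
proof -
  have "(\<Sum>k\<in>{0}. clifford_coeff \<nu> k * t ^ k) \<le> (\<Sum>k. clifford_coeff \<nu> k * t ^ k)"
    using clifford_sums[OF assms(1), of t] clifford_coeff_pos[OF assms(1)] assms(2)
    by (intro sum_le_suminf) (auto simp: sums_iff less_imp_le)
  then show ?thesis
    using clifford_sums[OF assms(1), of t] clifford_coeff_pos[OF assms(1), of 0] by (simp add: sums_iff)
qed

lemma one_le_pochhammer: "1 \<le> x \<Longrightarrow> 1 \<le> pochhammer x n" for x :: real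
proof (induction n)
  case (Suc n)
  then show ?case
    using mult_mono[of 1 "pochhammer x n" 1 "x + real n"] by (simp add: pochhammer_Suc)
qed simp

text \<open>After multiplication by \<open>Gamma (\<nu> + 1)\<close> the constant term is 1, while
  the other terms add up to at most \<open>(exp \<bar>t\<bar> - 1) / (\<nu> + 1) < 1\<close> in
  modulus.\<close>

lemma clifford_nonzero:
  assumes \<nu>: "0 \<le> \<nu>" and large: "exp \<bar>t\<bar> < \<nu> + 1"
  shows "clifford \<nu> t \<noteq> 0"
proof
  assume z: "clifford \<nu> t = 0"
  define d where "d = (\<lambda>k. Gamma (\<nu> + 1) * clifford_coeff \<nu> k)"
  have d: "(\<lambda>k. d k * t ^ k) sums 0"
    using sums_mult[OF clifford_sums[of \<nu> t], of "Gamma (\<nu> + 1)"] \<nu> z by (simp add: d_def mult_ac)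
  have Gpos: "0 < Gamma (\<nu> + 1)"
    using \<nu> by (intro Gamma_real_pos) simp
  have d_eq: "d k = 1 / (fact k * pochhammer (\<nu> + 1) k)" for k
  proof -
    have "\<nu> + 1 \<notin> \<int>\<^sub>\<le>\<^sub>0"
      using \<nu> by (auto elim!: nonpos_Ints_cases)
    then show ?thesis
      using Gpos by (simp add: d_def clifford_coeff_def pochhammer_Gamma add_ac)
  qed
  have d_le: "\<bar>d (Suc k) * t ^ Suc k\<bar> \<le> \<bar>t\<bar> ^ Suc k / fact (Suc k) / (\<nu> + 1)" for k
  proof -
    have "(\<nu> + 1) * 1 \<le> pochhammer (\<nu> + 1) (Suc k)"
      unfolding pochhammer_rec using \<nu> by (intro mult_left_mono one_le_pochhammer) auto
    then have "d (Suc k) \<le> 1 / (fact (Suc k) * (\<nu> + 1))"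
      unfolding d_eq using \<nu> by (intro divide_left_mono mult_left_mono) (auto intro!: mult_pos_pos)
    then show ?thesis
      using mult_right_mono[of "d (Suc k)" "1 / (fact (Suc k) * (\<nu> + 1))" "\<bar>t\<bar> ^ Suc k"]
        clifford_coeff_pos[of \<nu> "Suc k"] Gpos \<nu>
      by (simp add: abs_mult power_abs d_def)
  qed
  have "(\<lambda>k. d (Suc k) * t ^ Suc k) sums (0 - d 0 * t ^ 0)"
    using d by (subst sums_Suc_iff) simp
  moreover have "d 0 = 1"
    by (simp add: d_eq)
  ultimately have tail: "(\<lambda>k. d (Suc k) * t ^ Suc k) sums (- 1)"
    by simp
  have E: "(\<lambda>k. \<bar>t\<bar> ^ Suc k / fact (Suc k) / (\<nu> + 1)) sums ((exp \<bar>t\<bar> - 1) / (\<nu> + 1))"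
  proof (rule sums_divide)
    have "(\<lambda>k. \<bar>t\<bar> ^ k / fact k) sums exp \<bar>t\<bar>"
      using exp_converges[of "\<bar>t\<bar>"] by (simp add: divide_inverse mult.commute)
    then show "(\<lambda>k. \<bar>t\<bar> ^ Suc k / fact (Suc k)) sums (exp \<bar>t\<bar> - 1)"
      by (subst sums_Suc_iff) simp
  qed
  have "norm (\<Sum>k. d (Suc k) * t ^ Suc k) \<le> (\<Sum>k. \<bar>t\<bar> ^ Suc k / fact (Suc k) / (\<nu> + 1))"
    using d_le by (intro norm_suminf_le sums_summable[OF E]) simp
  then have "1 \<le> (exp \<bar>t\<bar> - 1) / (\<nu> + 1)"
    using tail E by (simp add: sums_iff)
  then show False
    using \<nu> large by (simp add: field_simps)
qed

text \<open>The recurrence, divided by \<open>t\<close>, passes a common zero on to all orders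
  \<open>\<nu> + k\<close>, which \<open>clifford_nonzero\<close> forbids for large
  \<open>k\<close>.\<close>

lemma clifford_no_common_zero:
  assumes \<nu>: "\<nu> > -1" and "t \<noteq> 0" and z: "clifford \<nu> t = 0" "clifford (\<nu> + 1) t = 0"
  shows False
proof -
  have "clifford (\<nu> + real k) t = 0 \<and> clifford (\<nu> + real k + 1) t = 0" for k
  proof (induction k)
    case (Suc k)
    then show ?case
      using clifford_recurrence[of "\<nu> + real k" t] \<nu> \<open>t \<noteq> 0\<close> by (simp add: add_ac)
  qed (use z in simp)
  moreover obtain k where "exp \<bar>t\<bar> + 1 < real k"
    using reals_Archimedean2 by blast
  then have "clifford (\<nu> + real k) t \<noteq> 0"
    using \<nu> exp_gt_zero[of "\<bar>t\<bar>"] by (intro clifford_nonzero) linarith+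
  ultimately show False
    by blast
qed

section \<open>Power series of the cross-product\<close>

text \<open>Here \<open>a\<close>, \<open>b\<close> are the series of orders \<open>\<nu>\<close>,
  \<open>\<nu> + 1\<close> at \<open>u\<close>, and \<open>A\<close>, \<open>B\<close> those at
  \<open>- u\<close>. The products \<open>a * A\<close>, \<open>b * A - a * B\<close>,
  \<open>b * B\<close> and \<open>B * a + A * b\<close> satisfy a first-order linear system;
  elimination links coefficients \<open>k\<close> and \<open>k + 2\<close> of the last one, and its
  coefficient at 1 vanishes.\<close>

lemma cross_product_coeffs:
  fixes \<nu> :: real
  assumes \<nu>: "\<nu> > -1"
  defines "a \<equiv> Abs_fps (clifford_coeff \<nu>)" and "b \<equiv> Abs_fps (clifford_coeff (\<nu> + 1))"
    and "A \<equiv> Abs_fps (\<lambda>k. (-1) ^ k * clifford_coeff \<nu> k)"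
    and "B \<equiv> Abs_fps (\<lambda>k. (-1) ^ k * clifford_coeff (\<nu> + 1) k)"
  shows "fps_nth (B * a + A * b) (Suc (2 * j)) = 0"
    and "fps_nth (B * a + A * b) (2 * j)
      = 2 / (Gamma (\<nu> + 1) * Gamma (\<nu> + 2)) * ((- 16) ^ j * limit_coeff (\<nu> + 1) (\<nu> + 2) j)"
proof -
  define c where "c = fps_const (\<nu> + 1)"
  have da: "fps_deriv a = b"
    by (rule fps_ext) (use clifford_coeff_Suc[of _ \<nu>] in \<open>simp add: a_def b_def\<close>)
  have dA: "fps_deriv A = - B"
  proof (rule fps_ext)
    fix k
    show "fps_nth (fps_deriv A) k = fps_nth (- B) k"
      using clifford_coeff_Suc[of k \<nu>, symmetric] by (simp add: A_def B_def)
  qed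
  have Xb: "fps_X * fps_deriv b = a - c * b"
  proof (rule fps_ext)
    fix k
    show "fps_nth (fps_X * fps_deriv b) k = fps_nth (a - c * b) k"
      using clifford_coeff_shift[OF \<nu>, of k] by (cases k) (simp_all add: a_def b_def c_def algebra_simps)
  qed
  have XB: "fps_X * fps_deriv B = A - c * B"
  proof (rule fps_ext)
    fix k
    have "(-1) ^ k * clifford_coeff \<nu> k = (-1) ^ k * ((\<nu> + real k + 1) * clifford_coeff (\<nu> + 1) k)"
      using clifford_coeff_shift[OF \<nu>, of k] by simp
    then show "fps_nth (fps_X * fps_deriv B) k = fps_nth (A - c * B) k"
      by (cases k) (simp_all add: A_def B_def c_def algebra_simps)
  qed
  define P where "P = a * A"
  define D where "D = b * A - a * B"
  define Q where "Q = b * B"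
  define H where "H = B * a + A * b"
  have dP: "fps_deriv P = D"
    by (simp add: P_def D_def da dA)
  have XD: "fps_X * fps_deriv D = - (c * D) - 2 * (fps_X * Q)"
  proof -
    have "fps_X * fps_deriv D
        = (fps_X * fps_deriv b) * A - 2 * (fps_X * (b * B)) - a * (fps_X * fps_deriv B)"
      by (simp add: D_def da dA algebra_simps)
    also have "\<dots> = - (c * D) - 2 * (fps_X * Q)"
      unfolding Xb XB D_def Q_def by (simp add: algebra_simps)
    finally show ?thesis .
  qed
  have XQ: "fps_X * fps_deriv Q = H - 2 * (c * Q)"
  proof -
    have "fps_X * fps_deriv Q = (fps_X * fps_deriv b) * B + b * (fps_X * fps_deriv B)"
      by (simp add: Q_def algebra_simps)
    also have "\<dots> = H - 2 * (c * Q)"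
      unfolding Xb XB H_def Q_def by (simp add: algebra_simps)
    finally show ?thesis .
  qed
  have XH: "fps_X * fps_deriv H = 2 * P - c * H"
  proof -
    have "fps_X * fps_deriv H = (fps_X * fps_deriv B) * a + A * (fps_X * fps_deriv b)"
      by (simp add: H_def da dA algebra_simps)
    also have "\<dots> = 2 * P - c * H"
      unfolding Xb XB H_def P_def by (simp add: algebra_simps)
    finally show ?thesis .
  qed
  have P_rec: "real (Suc k) * fps_nth P (Suc k) = fps_nth D k" for k
    using arg_cong[OF dP, of "\<lambda>f. fps_nth f k"] by simp
  have D_rec: "(\<nu> + real k + 2) * fps_nth D (Suc k) = - 2 * fps_nth Q k" for k
    using arg_cong[OF XD, of "\<lambda>f. fps_nth f (Suc k)"]
    by (simp add: c_def fps_numeral_nth algebra_simps numeral_fps_const)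
  have D0: "fps_nth D 0 = 0"
    using arg_cong[OF XD, of "\<lambda>f. fps_nth f 0"] \<nu> by (simp add: c_def numeral_fps_const)
  have Q_rec: "(2 * \<nu> + real k + 2) * fps_nth Q k = fps_nth H k" for k
    using arg_cong[OF XQ, of "\<lambda>f. fps_nth f k"]
    by (cases k) (simp_all add: c_def algebra_simps numeral_fps_const)
  have H_rec: "(\<nu> + real k + 1) * fps_nth H k = 2 * fps_nth P k" for k
    using arg_cong[OF XH, of "\<lambda>f. fps_nth f k"]
    by (cases k) (simp_all add: c_def algebra_simps numeral_fps_const)
  \<comment> \<open>The four relations form a closed system that determines all coefficients from \<open>P\<^sub>0\<close>.\<close>
  have step: "(\<nu> + real k + 3) * (2 * \<nu> + real k + 2) * (\<nu> + real k + 2) * (real k + 2) * fps_nth H (k + 2)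
      = - 4 * fps_nth H k" for k
  proof -
    have "(\<nu> + real k + 3) * (2 * \<nu> + real k + 2) * (\<nu> + real k + 2) * (real k + 2) * fps_nth H (k + 2)
        = (2 * \<nu> + real k + 2) * (\<nu> + real k + 2) * (real k + 2) * ((\<nu> + real (k + 2) + 1) * fps_nth H (k + 2))"
      by (simp add: algebra_simps)
    also have "\<dots> = 2 * (2 * \<nu> + real k + 2) * (\<nu> + real k + 2) * (real (Suc (Suc k)) * fps_nth P (Suc (Suc k)))"
      unfolding H_rec by (simp add: algebra_simps)
    also have "\<dots> = 2 * (2 * \<nu> + real k + 2) * ((\<nu> + real k + 2) * fps_nth D (Suc k))"
      unfolding P_rec by (simp add: algebra_simps)
    also have "\<dots> = - 4 * ((2 * \<nu> + real k + 2) * fps_nth Q k)"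
      unfolding D_rec by (simp add: algebra_simps)
    finally show ?thesis
      unfolding Q_rec .
  qed
  have nz: "(\<nu> + real k + 3) * (2 * \<nu> + real k + 2) * (\<nu> + real k + 2) * (real k + 2) \<noteq> 0" for k
  proof -
    have "\<nu> + real k + 3 > 0" "2 * \<nu> + real k + 2 > 0" "\<nu> + real k + 2 > 0" "real k + 2 > 0"
      using \<nu> by linarith+
    then show ?thesis
      by simp
  qed
  have "fps_nth H (Suc (2 * j)) = 0"
  proof (induction j)
    case 0
    show ?case
      using P_rec[of 0] D0 H_rec[of 1] \<nu> by simp
  next
    case (Suc j)
    then show ?case
      using step[of "Suc (2 * j)"] nz[of "Suc (2 * j)"] by simp
  qed
  then show "fps_nth (B * a + A * b) (Suc (2 * j)) = 0"
    by (simp add: H_def)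
  have "fps_nth H (2 * j)
      = 2 / (Gamma (\<nu> + 1) * Gamma (\<nu> + 2)) * ((- 16) ^ j * limit_coeff (\<nu> + 1) (\<nu> + 2) j)"
  proof (induction j)
    case 0
    show ?case
      by (simp add: H_def A_def B_def a_def b_def limit_coeff_def clifford_coeff_def add_ac)
  next
    case (Suc j)
    define l where "l = limit_coeff (\<nu> + 1) (\<nu> + 2)"
    define G where "G = 2 / (Gamma (\<nu> + 1) * Gamma (\<nu> + 2))"
    have p: "\<nu> + 1 + real j > 0" "\<nu> + 2 + real (2 * j) > 0" "\<nu> + 2 + real (Suc (2 * j)) > 0"
      using \<nu> by simp_all
    have "l (Suc j) = l j / (16 * real (Suc j) * (\<nu> + 1 + real j) * (\<nu> + 2 + real (2 * j)) * (\<nu> + 2 + real (Suc (2 * j))))"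
      unfolding l_def limit_coeff_def mult_2 add_Suc_right add_Suc pochhammer_Suc fact_Suc power_Suc
      by (simp add: algebra_simps)
    then have lS: "l j = 16 * real (Suc j) * (\<nu> + 1 + real j) * (\<nu> + 2 + real (2 * j)) * (\<nu> + 2 + real (Suc (2 * j))) * l (Suc j)"
      using p by (simp del: of_nat_Suc)
    \<comment> \<open>At the even index \<open>2 * j\<close> the second and fourth factors
      contribute an extra 4, which reconciles the constant 4 of \<open>step\<close> with the 16 of
      \<open>limit_coeff\<close>.\<close>
    have "(\<nu> + real (2 * j) + 3) * (2 * \<nu> + real (2 * j) + 2) * (\<nu> + real (2 * j) + 2) * (real (2 * j) + 2)
        * (G * ((- 16) ^ Suc j * l (Suc j))) = - 4 * (G * ((- 16) ^ j * l j))"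
      unfolding lS by (simp add: algebra_simps)
    also have "G * ((- 16) ^ j * l j) = fps_nth H (2 * j)"
      using Suc.IH by (simp add: G_def l_def)
    also note step[of "2 * j", symmetric]
    finally have "G * ((- 16) ^ Suc j * l (Suc j)) = fps_nth H (2 * j + 2)"
      using nz[of "2 * j"] by (simp only: mult_cancel_left) simp
    then show ?case
      by (simp add: G_def l_def)
  qed
  then show "fps_nth (B * a + A * b) (2 * j)
      = 2 / (Gamma (\<nu> + 1) * Gamma (\<nu> + 2)) * ((- 16) ^ j * limit_coeff (\<nu> + 1) (\<nu> + 2) j)"
    by (simp add: H_def)
qed

lemma fps_product_sums:
  fixes f g :: "nat \<Rightarrow> real"
  assumes "summable (\<lambda>k. norm (f k * u ^ k))" "summable (\<lambda>k. norm (g k * u ^ k))"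
  shows "(\<lambda>k. fps_nth (Abs_fps f * Abs_fps g) k * u ^ k) sums ((\<Sum>k. f k * u ^ k) * (\<Sum>k. g k * u ^ k))"
proof -
  have "fps_nth (Abs_fps f * Abs_fps g) k * u ^ k = (\<Sum>i\<le>k. f i * u ^ i * (g (k - i) * u ^ (k - i)))" for k
    unfolding fps_mult_nth sum_distrib_right atMost_atLeast0
    by (intro sum.cong) (auto simp: mult_ac simp flip: power_add)
  then show ?thesis
    using Cauchy_product_sums[OF assms] by simp
qed

text \<open>The Cauchy products add up to the series of \<open>cross_product_coeffs\<close>. Its odd
  part vanishes, leaving a series in \<open>u\<^sup>2\<close> whose powers of 16 are absorbed into
  the argument.\<close>

lemma clifford_cross_product:
  assumes \<nu>: "\<nu> > -1"
  shows "Gamma (\<nu> + 1) * Gamma (\<nu> + 2) / 2 *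
    (clifford (\<nu> + 1) (- u) * clifford \<nu> u + clifford \<nu> (- u) * clifford (\<nu> + 1) u)
    = limit_fun (\<nu> + 1) (\<nu> + 2) (16 * u\<^sup>2)"
proof -
  define a where "a = clifford_coeff \<nu>"
  define b where "b = clifford_coeff (\<nu> + 1)"
  define A where "A = (\<lambda>k. (-1) ^ k * clifford_coeff \<nu> k)"
  define B where "B = (\<lambda>k. (-1) ^ k * clifford_coeff (\<nu> + 1) k)"
  define H where "H = Abs_fps B * Abs_fps a + Abs_fps A * Abs_fps b"
  define G where "G = Gamma (\<nu> + 1) * Gamma (\<nu> + 2)"
  have G: "G > 0"
    using \<nu> by (auto simp: G_def intro!: mult_pos_pos Gamma_real_pos)
  have \<nu>1: "\<nu> + 1 > -1"
    using \<nu> by simp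
  have AB: "A k * u ^ k = clifford_coeff \<nu> k * (- u) ^ k" "B k * u ^ k = clifford_coeff (\<nu> + 1) k * (- u) ^ k" for k
    by (simp_all add: A_def B_def power_minus[of u])
  have S: "(\<Sum>k. a k * u ^ k) = clifford \<nu> u" "(\<Sum>k. b k * u ^ k) = clifford (\<nu> + 1) u"
    "(\<Sum>k. A k * u ^ k) = clifford \<nu> (- u)" "(\<Sum>k. B k * u ^ k) = clifford (\<nu> + 1) (- u)"
    unfolding AB unfolding a_def b_def
    using clifford_sums[OF \<nu>] clifford_sums[OF \<nu>1] by (simp_all add: sums_iff)
  have N: "summable (\<lambda>k. norm (a k * u ^ k))" "summable (\<lambda>k. norm (b k * u ^ k))"
    "summable (\<lambda>k. norm (A k * u ^ k))" "summable (\<lambda>k. norm (B k * u ^ k))"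
    unfolding AB unfolding a_def b_def
    using summable_norm_clifford[OF \<nu>] summable_norm_clifford[OF \<nu>1] by blast+
  have "(\<lambda>k. fps_nth H k * u ^ k) sums (clifford (\<nu> + 1) (- u) * clifford \<nu> u + clifford \<nu> (- u) * clifford (\<nu> + 1) u)"
    using sums_add[OF fps_product_sums[OF N(4,1)] fps_product_sums[OF N(3,2)]]
    by (simp add: S H_def distrib_right)
  then have "(\<lambda>j. fps_nth H (2 * j) * u ^ (2 * j)) sums
      (clifford (\<nu> + 1) (- u) * clifford \<nu> u + clifford \<nu> (- u) * clifford (\<nu> + 1) u)"
  proof (subst sums_mono_reindex[where g = "\<lambda>j. 2 * j" and f = "\<lambda>k. fps_nth H k * u ^ k"])
    fix k :: nat assume "k \<notin> range (\<lambda>j. 2 * j)"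
    then have "odd k"
      by auto
    then obtain j where "k = Suc (2 * j)"
      by (elim oddE) simp
    then show "fps_nth H k * u ^ k = 0"
      using cross_product_coeffs(1)[OF \<nu>, of j] by (simp add: H_def A_def B_def a_def b_def)
  qed (auto simp: strict_mono_def)
  from sums_mult[OF this, of "G / 2"]
  have "(\<lambda>j. G / 2 * (fps_nth H (2 * j) * u ^ (2 * j))) sums (G / 2 *
      (clifford (\<nu> + 1) (- u) * clifford \<nu> u + clifford \<nu> (- u) * clifford (\<nu> + 1) u))" .
  moreover have "G / 2 * (fps_nth H (2 * j) * u ^ (2 * j)) = (-1) ^ j * limit_coeff (\<nu> + 1) (\<nu> + 2) j * (16 * u\<^sup>2) ^ j" for j
  proof -
    have "fps_nth H (2 * j) = 2 / G * ((- 16) ^ j * limit_coeff (\<nu> + 1) (\<nu> + 2) j)"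
      using cross_product_coeffs(2)[OF \<nu>, of j] by (simp add: H_def A_def B_def a_def b_def G_def)
    then show ?thesis
      using G by (simp add: power_mult power_mult_distrib power_minus[of 16])
  qed
  ultimately show ?thesis
    by (simp add: limit_fun_def sums_iff G_def)
qed

lemma norm_W_eq_limit_fun:
  assumes "\<nu> > -1"
  shows "norm_W \<nu> x = limit_fun (\<nu> + 1) (\<nu> + 2) (x ^ 4)"
proof -
  have "16 * (x\<^sup>2 / 4)\<^sup>2 = x ^ 4"
    by (simp add: power_divide)
  then show ?thesis
    unfolding norm_W_eq_series[OF assms] clifford_cross_product[OF assms] by simp
qed

text \<open>With \<open>t = 16 * u\<^sup>2\<close>, a double zero makes \<open>H\<close> and its
  derivative vanish at \<open>u\<close>. As \<open>clifford\<close> is positive at \<open>u\<close>,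
  both orders \<open>\<nu>\<close> and \<open>\<nu> + 1\<close> would then vanish at
  \<open>- u\<close>.\<close>

lemma limit_fun_simple_zeros:
  assumes \<nu>: "\<nu> > -1" and t: "t > 0" and z: "limit_fun (\<nu> + 1) (\<nu> + 2) t = 0"
  shows "deriv (limit_fun (\<nu> + 1) (\<nu> + 2)) t \<noteq> 0"
proof
  assume dz: "deriv (limit_fun (\<nu> + 1) (\<nu> + 2)) t = 0"
  define u where "u = sqrt t / 4"
  have u: "u > 0" "16 * u\<^sup>2 = t"
    using t by (simp_all add: u_def power_divide)
  define G where "G = Gamma (\<nu> + 1) * Gamma (\<nu> + 2) / 2"
  have G: "G > 0"
    using \<nu> by (auto simp: G_def intro!: mult_pos_pos Gamma_real_pos)
  define H where "H = (\<lambda>u. clifford (\<nu> + 1) (- u) * clifford \<nu> u + clifford \<nu> (- u) * clifford (\<nu> + 1) u)"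
  have GH: "G * H u = limit_fun (\<nu> + 1) (\<nu> + 2) (16 * u\<^sup>2)" for u
    using clifford_cross_product[OF \<nu>, of u] by (simp add: G_def H_def)
  have H0: "H u = 0"
    using GH[of u] z u G by simp
  have neg: "((\<lambda>u. clifford \<mu> (- u)) has_real_derivative - clifford (\<mu> + 1) (- u)) (at u)"
    if "\<mu> > -1" for \<mu>
    by (rule DERIV_chain2[OF has_real_derivative_clifford[OF that], of uminus "-1", simplified])
      (auto intro!: derivative_eq_intros)
  define H' where "H' = clifford \<nu> (- u) * clifford (\<nu> + 2) u - clifford (\<nu> + 2) (- u) * clifford \<nu> u"
  have "(H has_real_derivative H') (at u)"
    unfolding H_def H'_def using \<nu>
    by (auto intro!: derivative_eq_intros neg has_real_derivative_clifford simp: algebra_simps)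
  then have "((\<lambda>u. G * H u) has_real_derivative G * H') (at u)"
    by (rule DERIV_cmult)
  moreover have "((\<lambda>u. limit_fun (\<nu> + 1) (\<nu> + 2) (16 * u\<^sup>2)) has_real_derivative 0 * (32 * u)) (at u)"
  proof (rule DERIV_chain2[where g = "\<lambda>u. 16 * u\<^sup>2"])
    show "(limit_fun (\<nu> + 1) (\<nu> + 2) has_real_derivative 0) (at (16 * u\<^sup>2))"
      using has_real_derivative_limit_fun[of "\<nu> + 1" "\<nu> + 2" t] \<nu> dz u(2) DERIV_imp_deriv
      by fastforce
  qed (auto intro!: derivative_eq_intros)
  ultimately have "H' = 0"
    using G unfolding GH by (auto dest: DERIV_unique)
  \<comment> \<open>The recurrence removes the order \<open>\<nu> + 2\<close>; this is
    \<open>(x W)' = 2 x J I\<close> in the variable \<open>u = x\<^sup>2 / 4\<close>.\<close>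
  moreover have "u * H' = 2 * (clifford \<nu> u * clifford \<nu> (- u)) - (\<nu> + 1) * H u"
  proof -
    have r: "u * clifford (\<nu> + 2) u = clifford \<nu> u - (\<nu> + 1) * clifford (\<nu> + 1) u"
      "u * clifford (\<nu> + 2) (- u) = (\<nu> + 1) * clifford (\<nu> + 1) (- u) - clifford \<nu> (- u)"
      using clifford_recurrence[OF \<nu>, of u] clifford_recurrence[OF \<nu>, of "- u"] by (simp_all add: algebra_simps)
    have "u * H' = clifford \<nu> (- u) * (u * clifford (\<nu> + 2) u) - (u * clifford (\<nu> + 2) (- u)) * clifford \<nu> u"
      by (simp add: H'_def algebra_simps)
    then show ?thesis
      unfolding r H_def by (simp add: algebra_simps)
  qed
  ultimately have A0: "clifford \<nu> (- u) = 0"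
    using H0 clifford_pos[OF \<nu>, of u] u(1) by simp
  then have "clifford (\<nu> + 1) (- u) = 0"
    using H0 clifford_pos[OF \<nu>, of u] u(1) by (simp add: H_def)
  then show False
    using clifford_no_common_zero[OF \<nu> _ A0] u(1) by simp
qed

subsection \<open>Bounds for the remainder\<close>

text \<open>In the application \<open>\<mu> i\<close> is the reciprocal fourth power of the positive
  zero number \<open>i + 1\<close>, and \<open>q\<close> below stands for
  \<open>x ^ 4\<close>.\<close>

locale decreasing_summable =
  fixes \<mu> :: "nat \<Rightarrow> real"
  assumes \<mu>_pos: "0 < \<mu> i"
    and \<mu>_strict: "i < j \<Longrightarrow> \<mu> j < \<mu> i"
    and \<mu>_summable: "summable \<mu>"
begin

definition power_sum :: "nat \<Rightarrow> real" where "power_sum k = (\<Sum>i. \<mu> i ^ k)"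

text \<open>The weight \<open>\<mu> i / \<mu> 0 - 1\<close> annihilates the term
  \<open>i = 0\<close>, the one with a pole at \<open>q = 1 / \<mu> 0\<close>; the other terms stay
  bounded up to that point.\<close>

definition remainder :: "nat \<Rightarrow> real \<Rightarrow> real" where
  "remainder n q = (\<Sum>i. (\<mu> i / \<mu> 0 - 1) * \<mu> i ^ Suc n / (1 - \<mu> i * q))"

lemma \<mu>_le0: "\<mu> i \<le> \<mu> 0"
  using \<mu>_strict[of 0 i] by (cases "i = 0") auto

lemma summable_power: "summable (\<lambda>i. \<mu> i ^ Suc k)"
proof (rule summable_comparison_test')
  show "summable (\<lambda>i. \<mu> 0 ^ k * \<mu> i)"
    by (intro summable_mult \<mu>_summable)
  show "norm (\<mu> i ^ Suc k) \<le> \<mu> 0 ^ k * \<mu> i" for i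
    using mult_right_mono[OF power_mono[OF \<mu>_le0, of i k], of "\<mu> i"] \<mu>_pos[of i]
    by (simp add: mult.commute)
qed

lemma power_sum_sums: "(\<lambda>i. \<mu> i ^ Suc k) sums power_sum (Suc k)"
  unfolding power_sum_def by (rule summable_sums[OF summable_power])

lemma denom_pos:
  assumes "0 \<le> q" "q < 1 / \<mu> 0"
  shows "0 < 1 - \<mu> i * q" "1 - \<mu> 0 * q \<le> 1 - \<mu> i * q" "1 - \<mu> i / \<mu> 0 \<le> 1 - \<mu> i * q"
proof -
  have "0 < 1 - \<mu> 0 * q"
    using assms \<mu>_pos[of 0] by (simp add: field_simps)
  moreover show "1 - \<mu> 0 * q \<le> 1 - \<mu> i * q"
    using mult_right_mono[OF \<mu>_le0 assms(1)] by simp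
  ultimately show "0 < 1 - \<mu> i * q"
    by (rule less_le_trans)
  show "1 - \<mu> i / \<mu> 0 \<le> 1 - \<mu> i * q"
    using mult_left_mono[of q "1 / \<mu> 0" "\<mu> i"] assms \<mu>_pos[of i] by simp
qed

lemma remainder_sums:
  assumes "0 \<le> q" "q < 1 / \<mu> 0"
  shows "(\<lambda>i. (\<mu> i / \<mu> 0 - 1) * \<mu> i ^ Suc n / (1 - \<mu> i * q)) sums remainder n q"
  unfolding remainder_def
proof (rule summable_sums, rule summable_comparison_test'[OF summable_power[of n]])
  fix i
  have d: "0 < 1 - \<mu> i * q" "1 - \<mu> i / \<mu> 0 \<le> 1 - \<mu> i * q" "\<mu> i / \<mu> 0 \<le> 1"
    using denom_pos(1,3)[OF assms, of i] \<mu>_le0[of i] \<mu>_pos[of 0] by simp_all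
  then have "\<bar>\<mu> i / \<mu> 0 - 1\<bar> / (1 - \<mu> i * q) \<le> 1"
    by simp
  from mult_right_mono[OF this, of "\<mu> i ^ Suc n"]
  show "norm ((\<mu> i / \<mu> 0 - 1) * \<mu> i ^ Suc n / (1 - \<mu> i * q)) \<le> \<mu> i ^ Suc n"
    using d(1) \<mu>_pos[of i] by (simp add: abs_mult)
qed

text \<open>The geometric expansion of \<open>y / (1 - y * q)\<close> times
  \<open>1 / M - q\<close>, with powers of \<open>q\<close> collected. One more term splits off by
  \<open>1 / (1 - y * q) = 1 + y * q / (1 - y * q)\<close>.\<close>

lemma geometric_split:
  fixes y q M :: real
  assumes "1 - y * q \<noteq> 0"
  shows "(1 / M - q) * (y / (1 - y * q)) = y / M + (\<Sum>m=1..n. (y ^ Suc m / M - y ^ m) * q ^ m)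
    + q ^ Suc n * ((y / M - 1) * y ^ Suc n / (1 - y * q))"
proof -
  define e w where "e = 1 / (1 - y * q)" and "w = 1 / M"
  have e: "(1 - y * q) * e = 1"
    using assms by (simp add: e_def)
  have "(w - q) * (y * e) = y * w + (\<Sum>m=1..n. (y ^ Suc m * w - y ^ m) * q ^ m)
      + q ^ Suc n * ((y * w - 1) * y ^ Suc n * e)"
  proof (induction n)
    case 0
    have "(w - q) * (y * e) = y * w + q * ((y * w - 1) * y * e)"
      using e by algebra
    then show ?case
      by simp
  next
    case (Suc n)
    have "q ^ Suc n * ((y * w - 1) * y ^ Suc n * e)
        = q ^ Suc n * ((y * w - 1) * y ^ Suc n) * ((1 - y * q) * e + y * q * e)"
      by (simp add: algebra_simps)
    also have "\<dots> = (y ^ Suc (Suc n) * w - y ^ Suc n) * q ^ Suc n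
          + q ^ Suc (Suc n) * ((y * w - 1) * y ^ Suc (Suc n) * e)"
      unfolding e by (simp add: algebra_simps)
    finally show ?case
      unfolding Suc.IH by simp
  qed
  then show ?thesis
    by (simp add: e_def w_def)
qed

text \<open>\<open>geometric_split\<close> for \<open>y = \<mu> i\<close> and
  \<open>M = \<mu> 0\<close>, summed over \<open>i\<close>; the differences of power sums are the
  later \<open>coeff_B\<close>.\<close>

lemma partial_fraction_expansion:
  assumes q: "0 \<le> q" "q < 1 / \<mu> 0"
  shows "(1 / \<mu> 0 - q) * (\<Sum>i. \<mu> i / (1 - \<mu> i * q))
    = power_sum 1 / \<mu> 0 + (\<Sum>m=1..n. (power_sum (Suc m) / \<mu> 0 - power_sum m) * q ^ m) + q ^ Suc n * remainder n q"
proof -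
  have "summable (\<lambda>i. \<mu> i / (1 - \<mu> i * q))"
  proof (rule summable_comparison_test'[OF summable_divide[OF \<mu>_summable]])
    show "norm (\<mu> i / (1 - \<mu> i * q)) \<le> \<mu> i / (1 - \<mu> 0 * q)" for i
      using denom_pos(1)[OF q] denom_pos(2)[OF q, of i] \<mu>_pos[of i] by (simp add: frac_le)
  qed
  then have "(\<lambda>i. (1 / \<mu> 0 - q) * (\<mu> i / (1 - \<mu> i * q))) sums ((1 / \<mu> 0 - q) * (\<Sum>i. \<mu> i / (1 - \<mu> i * q)))"
    by (intro sums_mult summable_sums)
  moreover have "(\<lambda>i. \<mu> i / \<mu> 0 + (\<Sum>m=1..n. (\<mu> i ^ Suc m / \<mu> 0 - \<mu> i ^ m) * q ^ m)
      + q ^ Suc n * ((\<mu> i / \<mu> 0 - 1) * \<mu> i ^ Suc n / (1 - \<mu> i * q)))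
      sums (power_sum 1 / \<mu> 0 + (\<Sum>m=1..n. (power_sum (Suc m) / \<mu> 0 - power_sum m) * q ^ m) + q ^ Suc n * remainder n q)"
  proof (intro sums_add sums_mult sums_mult2 sums_sum sums_diff sums_divide remainder_sums q power_sum_sums)
    show "\<mu> sums power_sum 1"
      using power_sum_sums[of 0] by simp
    show "(\<lambda>i. \<mu> i ^ m) sums power_sum m" if "m \<in> {1..n}" for m
      using power_sum_sums[of "m - 1"] that by (cases m) simp_all
  qed
  moreover have "(1 / \<mu> 0 - q) * (\<mu> i / (1 - \<mu> i * q)) = \<mu> i / \<mu> 0 + (\<Sum>m=1..n. (\<mu> i ^ Suc m / \<mu> 0 - \<mu> i ^ m) * q ^ m)
      + q ^ Suc n * ((\<mu> i / \<mu> 0 - 1) * \<mu> i ^ Suc n / (1 - \<mu> i * q))" for i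
    using denom_pos(1)[OF q, of i] by (intro geometric_split) auto
  ultimately show ?thesis
    by (simp add: sums_unique2)
qed

text \<open>Adding \<open>\<mu> i ^ Suc n\<close> to each term brings out the factor
  \<open>1 / \<mu> 0 - q\<close>. Term 0 becomes the constant \<open>\<mu> 0 ^ Suc n\<close>; the
  others are positive and sum to a multiple of \<open>1 / \<mu> 0 - q\<close> at most, which gives
  sharpness.\<close>

lemma remainder_lower:
  assumes q: "0 \<le> q" "q < 1 / \<mu> 0"
  shows "\<mu> 0 ^ Suc n - power_sum (Suc n) < remainder n q"
    and "remainder n q - (\<mu> 0 ^ Suc n - power_sum (Suc n)) \<le> (1 / \<mu> 0 - q) * (power_sum (Suc (Suc n)) / (1 - \<mu> 1 / \<mu> 0))"
proof -
  define f where "f = (\<lambda>i. (\<mu> i / \<mu> 0 - 1) * \<mu> i ^ Suc n / (1 - \<mu> i * q) + \<mu> i ^ Suc n)"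
  have f: "f sums (remainder n q + power_sum (Suc n))"
    unfolding f_def by (intro sums_add remainder_sums q power_sum_sums)
  have f0: "f 0 = \<mu> 0 ^ Suc n"
    using \<mu>_pos[of 0] by (simp add: f_def)
  have fS: "(\<lambda>i. f (Suc i)) sums (remainder n q - (\<mu> 0 ^ Suc n - power_sum (Suc n)))"
    using f by (subst sums_Suc_iff) (simp add: f0)
  have f_eq: "f i = \<mu> i ^ Suc (Suc n) * (1 / \<mu> 0 - q) / (1 - \<mu> i * q)" for i
    using denom_pos(1)[OF q, of i] by (simp add: f_def field_simps)
  have pos: "0 < f (Suc i)" for i
    unfolding f_eq using denom_pos(1)[OF q, of "Suc i"] \<mu>_pos[of "Suc i"] q(2)
    by (intro divide_pos_pos mult_pos_pos zero_less_power) auto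
  then have "0 < (\<Sum>i. f (Suc i))"
    by (intro suminf_pos sums_summable[OF fS])
  then show "\<mu> 0 ^ Suc n - power_sum (Suc n) < remainder n q"
    using fS by (simp add: sums_iff)
  \<comment> \<open>A lower bound, uniform in \<open>q\<close>, for all denominators except the one
    with index 0; strict decrease makes it positive.\<close>
  define c where "c = 1 - \<mu> 1 / \<mu> 0"
  have c: "0 < c"
    using \<mu>_strict[of 0 1] \<mu>_pos[of 0] by (simp add: c_def)
  have g: "(\<lambda>i. (1 / \<mu> 0 - q) * (\<mu> i ^ Suc (Suc n) / c)) sums ((1 / \<mu> 0 - q) * (power_sum (Suc (Suc n)) / c))"
    by (intro sums_mult sums_divide power_sum_sums)
  then have gS: "summable (\<lambda>i. (1 / \<mu> 0 - q) * (\<mu> (Suc i) ^ Suc (Suc n) / c))"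
    by (subst summable_Suc_iff) (rule sums_summable)
  have g0: "0 \<le> (1 / \<mu> 0 - q) * (\<mu> i ^ Suc (Suc n) / c)" for i
    using q c \<mu>_pos[of i] by (intro mult_nonneg_nonneg divide_nonneg_nonneg) auto
  have le: "f (Suc i) \<le> (1 / \<mu> 0 - q) * (\<mu> (Suc i) ^ Suc (Suc n) / c)" for i
  proof -
    have "\<mu> (Suc i) \<le> \<mu> 1"
      using \<mu>_strict[of 1 "Suc i"] by (cases "i = 0") auto
    then have "c \<le> 1 - \<mu> (Suc i) / \<mu> 0"
      using \<mu>_pos[of 0] by (simp add: c_def divide_right_mono)
    also have "\<dots> \<le> 1 - \<mu> (Suc i) * q"
      by (rule denom_pos(3)[OF q])
    finally have "\<mu> (Suc i) ^ Suc (Suc n) * (1 / \<mu> 0 - q) / (1 - \<mu> (Suc i) * q)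
        \<le> \<mu> (Suc i) ^ Suc (Suc n) * (1 / \<mu> 0 - q) / c"
      using c q \<mu>_pos[of "Suc i"] by (intro divide_left_mono mult_nonneg_nonneg) auto
    then show ?thesis
      unfolding f_eq by (simp add: mult_ac)
  qed
  have "remainder n q - (\<mu> 0 ^ Suc n - power_sum (Suc n)) = (\<Sum>i. f (Suc i))"
    using fS by (simp add: sums_iff)
  also have "\<dots> \<le> (\<Sum>i. (1 / \<mu> 0 - q) * (\<mu> (Suc i) ^ Suc (Suc n) / c))"
    using le sums_summable[OF fS] gS by (rule suminf_le)
  also have "\<dots> \<le> (\<Sum>i. (1 / \<mu> 0 - q) * (\<mu> i ^ Suc (Suc n) / c))"
    using suminf_split_head[OF sums_summable[OF g]] g0[of 0] by linarith
  finally show "remainder n q - (\<mu> 0 ^ Suc n - power_sum (Suc n)) \<le> (1 / \<mu> 0 - q) * (power_sum (Suc (Suc n)) / (1 - \<mu> 1 / \<mu> 0))"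
    using g by (simp add: sums_iff c_def)
qed

text \<open>The difference has the terms \<open>(1 - \<mu> i / \<mu> 0) * \<mu> i ^ (n + 2) * q / (1
  - \<mu> i * q)\<close>, which are nonnegative and at most
  \<open>q * \<mu> i ^ (n + 2)\<close>.\<close>

lemma remainder_upper:
  assumes q: "0 < q" "q < 1 / \<mu> 0"
  shows "remainder n q < power_sum (Suc (Suc n)) / \<mu> 0 - power_sum (Suc n)"
    and "power_sum (Suc (Suc n)) / \<mu> 0 - power_sum (Suc n) - remainder n q \<le> q * power_sum (Suc (Suc n))"
proof -
  have q0: "0 \<le> q"
    using q by simp
  note dp = denom_pos[OF q0 q(2)]
  define f where "f = (\<lambda>i. \<mu> i ^ Suc (Suc n) / \<mu> 0 - \<mu> i ^ Suc n - (\<mu> i / \<mu> 0 - 1) * \<mu> i ^ Suc n / (1 - \<mu> i * q))"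
  have f: "f sums (power_sum (Suc (Suc n)) / \<mu> 0 - power_sum (Suc n) - remainder n q)"
    unfolding f_def by (intro sums_diff sums_divide remainder_sums q0 q power_sum_sums)
  have f_eq: "f i = (1 - \<mu> i / \<mu> 0) * \<mu> i ^ Suc (Suc n) * q / (1 - \<mu> i * q)" for i
    using dp(1)[of i] \<mu>_pos[of 0] by (simp add: f_def field_simps)
  have le1: "\<mu> i / \<mu> 0 \<le> 1" for i
    using \<mu>_le0[of i] \<mu>_pos[of 0] by simp
  have nonneg: "0 \<le> f i" for i
    unfolding f_eq using dp(1)[of i] \<mu>_pos[of i] q le1[of i]
    by (intro divide_nonneg_nonneg mult_nonneg_nonneg) auto
  \<comment> \<open>Term 0 vanishes, so strictness comes from index 1, where
    \<open>\<mu> 1 < \<mu> 0\<close>.\<close>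
  have "0 < f 1"
    unfolding f_eq using dp(1)[of 1] \<mu>_pos[of 1] \<mu>_pos[of 0] q \<mu>_strict[of 0 1]
    by (intro divide_pos_pos mult_pos_pos) auto
  with nonneg have "0 < (\<Sum>i. f i)"
    using suminf_pos2[OF sums_summable[OF f]] by blast
  then show "remainder n q < power_sum (Suc (Suc n)) / \<mu> 0 - power_sum (Suc n)"
    using f by (simp add: sums_iff)
  have g: "(\<lambda>i. q * \<mu> i ^ Suc (Suc n)) sums (q * power_sum (Suc (Suc n)))"
    by (intro sums_mult power_sum_sums)
  have le: "f i \<le> q * \<mu> i ^ Suc (Suc n)" for i
  proof -
    have "(1 - \<mu> i / \<mu> 0) / (1 - \<mu> i * q) \<le> 1"
      using dp(1,3)[of i] by simp
    from mult_right_mono[OF this, of "q * \<mu> i ^ Suc (Suc n)"] show ?thesis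
      unfolding f_eq using q \<mu>_pos[of i] by (simp add: mult_ac)
  qed
  show "power_sum (Suc (Suc n)) / \<mu> 0 - power_sum (Suc n) - remainder n q \<le> q * power_sum (Suc (Suc n))"
    by (rule sums_le[OF le f g])
qed

text \<open>The second estimate of \<open>remainder_lower\<close> squeezes the remainder onto its
  lower bound as \<open>q\<close> tends to \<open>1 / \<mu> 0\<close> from the left.\<close>

lemma remainder_lower_sharp:
  assumes "\<And>q. 0 < q \<Longrightarrow> q < 1 / \<mu> 0 \<Longrightarrow> c < remainder n q"
  shows "c \<le> \<mu> 0 ^ Suc n - power_sum (Suc n)"
proof (rule tendsto_lowerbound)
  let ?r = "\<mu> 0 ^ Suc n - power_sum (Suc n)" and ?C = "power_sum (Suc (Suc n)) / (1 - \<mu> 1 / \<mu> 0)"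
  have "((\<lambda>q. ?r + (1 / \<mu> 0 - q) * ?C) \<longlongrightarrow> ?r + (1 / \<mu> 0 - 1 / \<mu> 0) * ?C) (at_left (1 / \<mu> 0))"
    by (intro tendsto_intros)
  then show "((\<lambda>q. ?r + (1 / \<mu> 0 - q) * ?C) \<longlongrightarrow> ?r) (at_left (1 / \<mu> 0))"
    by simp
  have "\<forall>\<^sub>F q in at_left (1 / \<mu> 0). q \<in> {0<..<1 / \<mu> 0}"
    using \<mu>_pos[of 0] by (intro eventually_at_left_real) simp
  then show "\<forall>\<^sub>F q in at_left (1 / \<mu> 0). c \<le> ?r + (1 / \<mu> 0 - q) * ?C"
  proof eventually_elim
    case (elim q)
    then show ?case
      using assms[of q] remainder_lower(2)[of q n] by simp
  qed
qed simp

text \<open>The second estimate of \<open>remainder_upper\<close> squeezes the remainder onto its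
  upper bound as \<open>q\<close> tends to 0 from the right.\<close>

lemma remainder_upper_sharp:
  assumes "\<And>q. 0 < q \<Longrightarrow> q < 1 / \<mu> 0 \<Longrightarrow> remainder n q < c"
  shows "power_sum (Suc (Suc n)) / \<mu> 0 - power_sum (Suc n) \<le> c"
proof (rule tendsto_upperbound)
  let ?s = "power_sum (Suc (Suc n)) / \<mu> 0 - power_sum (Suc n)"
  have "((\<lambda>q. ?s - q * power_sum (Suc (Suc n))) \<longlongrightarrow> ?s - 0 * power_sum (Suc (Suc n))) (at_right 0)"
    by (intro tendsto_intros)
  then show "((\<lambda>q. ?s - q * power_sum (Suc (Suc n))) \<longlongrightarrow> ?s) (at_right 0)"
    by simp
  have "\<forall>\<^sub>F q in at_right 0. q \<in> {0<..<1 / \<mu> 0}"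
    using \<mu>_pos[of 0] by (intro eventually_at_right_real) simp
  then show "\<forall>\<^sub>F q in at_right 0. ?s - q * power_sum (Suc (Suc n)) \<le> c"
  proof eventually_elim
    case (elim q)
    then show ?case
      using assms[of q] remainder_upper(2)[of q n] by simp
  qed
qed simp

text \<open>Evaluates the sum in \<open>const_r\<close>, since \<open>x ^ 4 = 1 / \<mu> 0\<close> at
  the first zero.\<close>

lemma telescope:
  "(\<Sum>m=1..n. (power_sum (Suc m) / \<mu> 0 - power_sum m) / \<mu> 0 ^ m) = power_sum (Suc n) / \<mu> 0 ^ Suc n - power_sum 1 / \<mu> 0"
  by (induction n) (auto simp: diff_divide_distrib)

end

section \<open>Zeros of the cross-product and the sharp bounds\<close>

text \<open>Carries the zeros in \<open>t = x ^ 4\<close> back to \<open>x\<close>. The sum of the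
  \<open>\<mu> i\<close> is read off from the logarithmic derivative at 0; the 16 in the last
  formula is the 4 of the definition times the 4 of the chain rule.\<close>

lemma limit_fun_spectrum:
  assumes \<nu>: "\<nu> > -1"
  obtains \<mu> where "decreasing_summable \<mu>"
    "\<And>x. 0 < x \<Longrightarrow> cross_W \<nu> x = 0 \<longleftrightarrow> (\<exists>i. x = root 4 (1 / \<mu> i))"
    "16 * pochhammer (\<nu> + 1) 3 * (\<Sum>i. \<mu> i) = 1"
    "\<And>x. x \<noteq> 0 \<Longrightarrow> x ^ 4 < 1 / \<mu> 0 \<Longrightarrow> scaled_log_deriv_W \<nu> x
      = 16 * pochhammer (\<nu> + 1) 3 * (\<Sum>i. \<mu> i / (1 - \<mu> i * x ^ 4))"
proof -
  define F where "F = limit_fun (\<nu> + 1) (\<nu> + 2)"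
  have ab: "\<nu> + 1 > 0" "\<nu> + 2 \<ge> 1"
    using \<nu> by auto
  obtain \<mu> :: "nat \<Rightarrow> real" where \<mu>: "antimono \<mu>" "\<And>i. 0 < \<mu> i" "summable \<mu>"
    "\<And>t. 0 \<le> t \<Longrightarrow> F t = 0 \<longleftrightarrow> (\<exists>i. \<mu> i * t = 1)"
    "\<And>i j. i \<noteq> j \<Longrightarrow> \<mu> i = \<mu> j \<Longrightarrow> deriv F (1 / \<mu> i) = 0"
    "\<And>t. 0 \<le> t \<Longrightarrow> \<mu> 0 * t < 1 \<Longrightarrow> (\<Sum>i. \<mu> i / (1 - \<mu> i * t)) = - deriv F t / F t"
    unfolding F_def by (rule limit_fun_zeros[OF ab]) (blast intro: that)
  have F_deriv: "(F has_real_derivative deriv F t) (at t)" for t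
    using has_real_derivative_limit_fun[OF ab, of t] DERIV_imp_deriv unfolding F_def by fastforce
  \<comment> \<open>A repeated value would be a double zero; simplicity makes the sequence strictly
    decreasing.\<close>
  have distinct: "\<mu> i \<noteq> \<mu> j" if "i \<noteq> j" for i j
  proof
    assume "\<mu> i = \<mu> j"
    then have "deriv F (1 / \<mu> i) = 0"
      using \<mu>(5) that by blast
    moreover have "F (1 / \<mu> i) = 0"
      using \<mu>(2)[of i] by (subst \<mu>(4)) (auto intro!: exI[of _ i])
    ultimately show False
      using limit_fun_simple_zeros[OF \<nu>, of "1 / \<mu> i"] \<mu>(2)[of i] by (simp add: F_def)
  qed
  have "decreasing_summable \<mu>"
  proof
    show "\<mu> j < \<mu> i" if "i < j" for i j
      using antimonoD[OF \<mu>(1), of i j] distinct[of i j] that by simp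
  qed (use \<mu> in auto)
  moreover have "cross_W \<nu> x = 0 \<longleftrightarrow> (\<exists>i. x = root 4 (1 / \<mu> i))" if "0 < x" for x
  proof -
    have "0 < Gamma (\<nu> + 1)" "0 < Gamma (\<nu> + 2)"
      using \<nu> by (auto intro!: Gamma_real_pos)
    then have "cross_W \<nu> x = 0 \<longleftrightarrow> norm_W \<nu> x = 0"
      using that by (simp add: norm_W_def)
    also have "\<dots> \<longleftrightarrow> (\<exists>i. \<mu> i * x ^ 4 = 1)"
      unfolding norm_W_eq_limit_fun[OF \<nu>] F_def[symmetric] by (rule \<mu>(4)) simp
    also have "\<dots> \<longleftrightarrow> (\<exists>i. x = root 4 (1 / \<mu> i))"
    proof (intro ex_cong1)
      fix i
      have "\<mu> i * x ^ 4 = 1 \<longleftrightarrow> x ^ 4 = 1 / \<mu> i"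
        using \<mu>(2)[of i] by (auto simp: field_simps)
      also have "\<dots> \<longleftrightarrow> x = root 4 (1 / \<mu> i)"
        using that \<mu>(2)[of i] real_root_pos_unique[of 4 x "1 / \<mu> i"] real_root_pow_pos2[of 4 "1 / \<mu> i"]
        by auto
      finally show "\<mu> i * x ^ 4 = 1 \<longleftrightarrow> x = root 4 (1 / \<mu> i)" .
    qed
    finally show ?thesis .
  qed
  moreover have "16 * pochhammer (\<nu> + 1) 3 * (\<Sum>i. \<mu> i) = 1"
  proof -
    have "(\<Sum>i. \<mu> i) = - deriv F 0 / F 0"
      using \<mu>(6)[of 0] by simp
    moreover have "deriv F 0 = - limit_coeff (\<nu> + 1) (\<nu> + 2) 1"
      using DERIV_imp_deriv[OF has_real_derivative_limit_fun[OF ab, of 0]]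
      unfolding F_def powser_zero by (simp add: diffs_def)
    moreover have "F 0 = 1"
      by (simp add: F_def limit_fun_0)
    ultimately have S: "(\<Sum>i. \<mu> i) = limit_coeff (\<nu> + 1) (\<nu> + 2) 1"
      by simp
    have "pochhammer (\<nu> + 1) 3 = (\<nu> + 1) * (\<nu> + 2) * (\<nu> + 3)"
      "pochhammer (\<nu> + 2) 2 = (\<nu> + 2) * (\<nu> + 3)"
      by (simp_all add: eval_nat_numeral pochhammer_Suc algebra_simps)
    then show ?thesis
      unfolding S limit_coeff_def using \<nu> by simp
  qed
  moreover have "scaled_log_deriv_W \<nu> x
      = 16 * pochhammer (\<nu> + 1) 3 * (\<Sum>i. \<mu> i / (1 - \<mu> i * x ^ 4))"
    if "x \<noteq> 0" "x ^ 4 < 1 / \<mu> 0" for x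
  proof -
    have W: "norm_W \<nu> = (\<lambda>x. F (x ^ 4))"
      by (rule ext) (simp add: norm_W_eq_limit_fun[OF \<nu>] F_def)
    have "((\<lambda>x. F (x ^ 4)) has_real_derivative deriv F (x ^ 4) * (4 * x ^ 3)) (at x)"
      by (rule DERIV_chain2[where g = "\<lambda>x. x ^ 4", OF F_deriv]) (auto intro!: derivative_eq_intros)
    then have "deriv (norm_W \<nu>) x = deriv F (x ^ 4) * (4 * x ^ 3)"
      unfolding W by (rule DERIV_imp_deriv)
    moreover have "(\<Sum>i. \<mu> i / (1 - \<mu> i * x ^ 4)) = - deriv F (x ^ 4) / F (x ^ 4)"
      using that \<mu>(2)[of 0] by (intro \<mu>(6)) (auto simp: field_simps)
    ultimately show ?thesis
      using that(1) by (simp add: scaled_log_deriv_W_def W)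
  qed
  ultimately show ?thesis
    using that by blast
qed

text \<open>The zeros up to the one belonging to \<open>\<mu> i\<close> are those of indices 0 to
  \<open>i\<close>, so the count is \<open>Suc i\<close>, and the count determines the zero.\<close>

lemma (in decreasing_summable) W_zero_eq:
  assumes zeros: "\<And>x. 0 < x \<Longrightarrow> cross_W \<nu> x = 0 \<longleftrightarrow> (\<exists>i. x = root 4 (1 / \<mu> i))"
  shows "W_zero \<nu> (Suc i) = root 4 (1 / \<mu> i)"
proof -
  define g where "g = (\<lambda>i. root 4 (1 / \<mu> i))"
  have zeros_g: "cross_W \<nu> x = 0 \<longleftrightarrow> (\<exists>i. x = g i)" if "0 < x" for x
    using zeros[OF that] by (simp add: g_def)
  have g_pos: "0 < g i" for i
    using \<mu>_pos[of i] by (simp add: g_def)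
  have "strict_mono g"
    using \<mu>_strict \<mu>_pos by (intro strict_monoI) (simp add: g_def frac_less2)
  then have card_eq: "card {y. 0 < y \<and> y \<le> g i \<and> cross_W \<nu> y = 0} = Suc i" for i
  proof -
    have "{y. 0 < y \<and> y \<le> g i \<and> cross_W \<nu> y = 0} = g ` {..i}"
      using zeros_g g_pos strict_mono_less_eq[OF \<open>strict_mono g\<close>] by auto
    then show ?thesis
      using strict_mono_imp_inj_on[OF \<open>strict_mono g\<close>] by (simp add: card_image inj_on_subset)
  qed
  have "W_zero \<nu> (Suc i) = g i"
    unfolding W_zero_def
  proof (rule the_equality)
    show "0 < g i \<and> cross_W \<nu> (g i) = 0 \<and> card {y. 0 < y \<and> y \<le> g i \<and> cross_W \<nu> y = 0} = Suc i"
      using g_pos zeros_g card_eq by auto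
    fix x assume x: "0 < x \<and> cross_W \<nu> x = 0 \<and> card {y. 0 < y \<and> y \<le> x \<and> cross_W \<nu> y = 0} = Suc i"
    then obtain j where "x = g j"
      using zeros_g[of x] by auto
    with x card_eq[of j] show "x = g i"
      by simp
  qed
  then show ?thesis
    by (simp add: g_def)
qed

theorem theorem12:
  fixes \<nu> :: real and n :: nat
  assumes "\<nu> > -1" and "n \<ge> 1"
  shows "(\<forall>x. 0 < \<bar>x\<bar> \<and> \<bar>x\<bar> < W_zero \<nu> 1 \<longrightarrow>
            bound \<nu> n (const_r \<nu> n) x < scaled_log_deriv_W \<nu> x \<and>
            scaled_log_deriv_W \<nu> x < bound \<nu> n (const_s \<nu> n) x) \<and>
         (\<forall>c. (\<forall>x. 0 < \<bar>x\<bar> \<and> \<bar>x\<bar> < W_zero \<nu> 1 \<longrightarrow> bound \<nu> n c x < scaled_log_deriv_W \<nu> x)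
              \<longrightarrow> c \<le> const_r \<nu> n) \<and>
         (\<forall>c. (\<forall>x. 0 < \<bar>x\<bar> \<and> \<bar>x\<bar> < W_zero \<nu> 1 \<longrightarrow> scaled_log_deriv_W \<nu> x < bound \<nu> n c x)
              \<longrightarrow> const_s \<nu> n \<le> c)"
proof -
  obtain \<mu> where "decreasing_summable \<mu>"
    and zeros: "\<And>x. 0 < x \<Longrightarrow> cross_W \<nu> x = 0 \<longleftrightarrow> (\<exists>i. x = root 4 (1 / \<mu> i))"
    and sum1: "16 * pochhammer (\<nu> + 1) 3 * (\<Sum>i. \<mu> i) = 1"
    and scaled: "\<And>x. x \<noteq> 0 \<Longrightarrow> x ^ 4 < 1 / \<mu> 0 \<Longrightarrow> scaled_log_deriv_W \<nu> x
      = 16 * pochhammer (\<nu> + 1) 3 * (\<Sum>i. \<mu> i / (1 - \<mu> i * x ^ 4))"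
    by (rule limit_fun_spectrum[OF assms(1)]) blast
  then interpret decreasing_summable \<mu>
    by simp
  define M where "M = \<mu> 0"
  define \<kappa> where "\<kappa> = 16 * pochhammer (\<nu> + 1) 3"
  have M: "M > 0"
    using \<mu>_pos by (simp add: M_def)
  have \<kappa>: "\<kappa> > 0"
    using pochhammer_pos[of "\<nu> + 1" 3] assms(1) by (simp add: \<kappa>_def)
  have \<kappa>_sum: "\<kappa> * power_sum 1 = 1"
    using sum1 by (simp add: \<kappa>_def power_sum_def)
  have zero_pow: "W_zero \<nu> (Suc i) ^ 4 = 1 / \<mu> i" for i
    using \<mu>_pos[of i] by (simp add: W_zero_eq[OF zeros])
  have \<gamma>: "W_zero \<nu> 1 ^ 4 = 1 / M" "W_zero \<nu> (Suc 0) ^ 4 = 1 / M"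
    using zero_pow[of 0] by (simp_all add: M_def)
  have \<gamma>_pos: "0 < W_zero \<nu> 1"
    using W_zero_eq[OF zeros, of 0] \<mu>_pos[of 0] by simp
  have \<gamma>_pow: "W_zero \<nu> 1 ^ (4 * m) = 1 / M ^ m" for m
    unfolding power_mult \<gamma> by (simp add: power_divide)
  \<comment> \<open>For \<open>m = 0\<close> both sides are the same \<open>suminf\<close> of the
    constant 1.\<close>
  have ray: "rayleigh \<nu> (4 * m) = power_sum m" for m
    by (simp add: rayleigh_def power_sum_def power_mult zero_pow power_divide)
  have B: "coeff_B \<nu> m = power_sum (Suc m) / M - power_sum m" for m
    using ray[of "Suc m"] ray[of m] by (simp add: coeff_B_def \<gamma> add.commute)
  \<comment> \<open>By \<open>\<kappa>_sum\<close> the subtracted \<open>1 / M / \<kappa>\<close>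
    equals \<open>power_sum 1 / M\<close> and cancels the boundary term of the telescoping
    sum.\<close>
  have r: "const_r \<nu> n = M ^ Suc n - power_sum (Suc n)"
  proof -
    have "(\<Sum>m=1..n. coeff_B \<nu> m * W_zero \<nu> 1 ^ (4 * m)) = power_sum (Suc n) / M ^ Suc n - power_sum 1 / M"
      unfolding B \<gamma>_pow M_def using telescope[of n] by simp
    moreover have "1 / M / \<kappa> = power_sum 1 / M"
      using \<kappa>_sum \<kappa> M by (simp add: field_simps)
    moreover have "1 / W_zero \<nu> 1 ^ (4 * n + 4) = M ^ Suc n"
      using \<gamma>_pow[of "Suc n"] by (simp add: add.commute)
    ultimately have "const_r \<nu> n = M ^ Suc n * (1 - power_sum (Suc n) / M ^ Suc n)"
      by (simp add: const_r_def \<gamma> \<kappa>_def)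
    then show ?thesis
      using M by (simp add: right_diff_distrib)
  qed
  have s: "const_s \<nu> n = power_sum (Suc (Suc n)) / M - power_sum (Suc n)"
    by (simp add: const_s_def B)
  have range: "x \<noteq> 0" "0 < x ^ 4" "x ^ 4 < 1 / M" if "0 < \<bar>x\<bar>" "\<bar>x\<bar> < W_zero \<nu> 1" for x
  proof -
    have "\<bar>x\<bar> ^ 4 < W_zero \<nu> 1 ^ 4"
      using that by (intro power_strict_mono) auto
    then show "x ^ 4 < 1 / M"
      unfolding \<gamma> by simp
  qed (use that in auto)
  \<comment> \<open>Since \<open>\<kappa> * power_sum 1 = 1\<close>, the expansion reproduces
    \<open>poly_S\<close> exactly, so the function is \<open>bound\<close> with the remainder in
    place of the constant \<open>c\<close>.\<close>
  have scaled_eq: "scaled_log_deriv_W \<nu> x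
      = bound \<nu> n c x + \<kappa> * x ^ (4 * n + 4) / (1 / M - x ^ 4) * (remainder n (x ^ 4) - c)"
    and factor_pos: "0 < \<kappa> * x ^ (4 * n + 4) / (1 / M - x ^ 4)"
    if "0 < \<bar>x\<bar>" "\<bar>x\<bar> < W_zero \<nu> 1" for x c
  proof -
    define q where "q = x ^ 4"
    have q: "0 < q" "q < 1 / M"
      using range[OF that] by (simp_all add: q_def)
    have xq: "x ^ (4 * n + 4) = q ^ Suc n"
      by (simp add: q_def power_add flip: power_mult)
    show "0 < \<kappa> * x ^ (4 * n + 4) / (1 / M - x ^ 4)"
      unfolding xq q_def[symmetric] using q \<kappa> by simp
    have "scaled_log_deriv_W \<nu> x = \<kappa> * (\<Sum>i. \<mu> i / (1 - \<mu> i * q))"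
      using scaled[of x] range[OF that] by (simp add: q_def \<kappa>_def M_def)
    then have "(1 / M - q) * scaled_log_deriv_W \<nu> x = \<kappa> * ((1 / M - q) * (\<Sum>i. \<mu> i / (1 - \<mu> i * q)))"
      by simp
    also have "(1 / M - q) * (\<Sum>i. \<mu> i / (1 - \<mu> i * q))
        = power_sum 1 / M + (\<Sum>m=1..n. (power_sum (Suc m) / M - power_sum m) * q ^ m) + q ^ Suc n * remainder n q"
      unfolding M_def using q by (intro partial_fraction_expansion) (auto simp: M_def)
    also have "(\<Sum>m=1..n. (power_sum (Suc m) / M - power_sum m) * q ^ m) = (\<Sum>m=1..n. coeff_B \<nu> m * x ^ (4 * m))"
      by (simp add: B q_def power_mult)
    also have "\<kappa> * (power_sum 1 / M + \<dots> + q ^ Suc n * remainder n q) = poly_S \<nu> n x + \<kappa> * (q ^ Suc n * remainder n q)"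
      using \<kappa>_sum by (simp add: poly_S_def \<gamma> \<kappa>_def[symmetric] distrib_left)
    finally have "scaled_log_deriv_W \<nu> x = (poly_S \<nu> n x + \<kappa> * (q ^ Suc n * remainder n q)) / (1 / M - q)"
      using q by (simp add: eq_divide_eq mult.commute)
    also have "\<dots> = bound \<nu> n c x + \<kappa> * q ^ Suc n / (1 / M - q) * (remainder n q - c)"
      unfolding bound_def \<gamma> xq q_def[symmetric] \<kappa>_def[symmetric]
      by (simp add: add_divide_distrib diff_divide_distrib algebra_simps)
    finally show "scaled_log_deriv_W \<nu> x
        = bound \<nu> n c x + \<kappa> * x ^ (4 * n + 4) / (1 / M - x ^ 4) * (remainder n (x ^ 4) - c)"
      by (simp add: xq q_def)
  qed
  \<comment> \<open>The inequalities and the sharpness claims all reduce to comparing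
    \<open>c\<close> with the remainder.\<close>
  have lower_iff: "bound \<nu> n c x < scaled_log_deriv_W \<nu> x \<longleftrightarrow> c < remainder n (x ^ 4)"
    and upper_iff: "scaled_log_deriv_W \<nu> x < bound \<nu> n c x \<longleftrightarrow> remainder n (x ^ 4) < c"
    if "0 < \<bar>x\<bar>" "\<bar>x\<bar> < W_zero \<nu> 1" for x c
  proof -
    define C where "C = \<kappa> * x ^ (4 * n + 4) / (1 / M - x ^ 4)"
    have "0 < C"
      using factor_pos[OF that] by (simp add: C_def)
    moreover have "scaled_log_deriv_W \<nu> x = bound \<nu> n c x + C * (remainder n (x ^ 4) - c)"
      using scaled_eq[OF that, of c] by (simp add: C_def)
    ultimately show "bound \<nu> n c x < scaled_log_deriv_W \<nu> x \<longleftrightarrow> c < remainder n (x ^ 4)"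
      "scaled_log_deriv_W \<nu> x < bound \<nu> n c x \<longleftrightarrow> remainder n (x ^ 4) < c"
      by (simp_all add: zero_less_mult_iff mult_less_0_iff)
  qed
  \<comment> \<open>For sharpness: an assumption on all admissible \<open>x\<close> reaches every
    \<open>q\<close> in the open interval.\<close>
  have fourth_root: "\<exists>x. 0 < \<bar>x\<bar> \<and> \<bar>x\<bar> < W_zero \<nu> 1 \<and> x ^ 4 = q" if "0 < q" "q < 1 / M" for q
  proof (intro exI conjI)
    have "root 4 q < root 4 (1 / M)"
      using that by simp
    then show "\<bar>root 4 q\<bar> < W_zero \<nu> 1"
      using W_zero_eq[OF zeros, of 0] that by (simp add: M_def)
  qed (use that in auto)
  show ?thesis
  proof (intro conjI allI impI)
    fix x assume x: "0 < \<bar>x\<bar> \<and> \<bar>x\<bar> < W_zero \<nu> 1"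
    then show "bound \<nu> n (const_r \<nu> n) x < scaled_log_deriv_W \<nu> x"
      using remainder_lower(1)[of "x ^ 4" n] range[of x] by (simp add: lower_iff r M_def)
    from x show "scaled_log_deriv_W \<nu> x < bound \<nu> n (const_s \<nu> n) x"
      using remainder_upper(1)[of "x ^ 4" n] range[of x] by (simp add: upper_iff s M_def)
  next
    fix c assume "\<forall>x. 0 < \<bar>x\<bar> \<and> \<bar>x\<bar> < W_zero \<nu> 1 \<longrightarrow> bound \<nu> n c x < scaled_log_deriv_W \<nu> x"
    then have "c < remainder n q" if "0 < q" "q < 1 / \<mu> 0" for q
      using fourth_root[of q] that lower_iff by (auto simp: M_def)
    then show "c \<le> const_r \<nu> n"
      using remainder_lower_sharp[of c n] by (simp add: r M_def)
  next
    fix c assume "\<forall>x. 0 < \<bar>x\<bar> \<and> \<bar>x\<bar> < W_zero \<nu> 1 \<longrightarrow> scaled_log_deriv_W \<nu> x < bound \<nu> n c x"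
    then have "remainder n q < c" if "0 < q" "q < 1 / \<mu> 0" for q
      using fourth_root[of q] that upper_iff by (auto simp: M_def)
    then show "const_s \<nu> n \<le> c"
      using remainder_upper_sharp[of n c] by (simp add: s M_def)
  qed
qed

end
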